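(* Let $K$ be a field, $P=K[x_1,\dots,x_n]$ with $n\ge1$, and let $\sigma$ be a degree compatible term ordering on $\mathbb T^n$. Let $\mathcal F=\{f_1,\ldots,f_s\}\subset P\setminus\{0\}$ be marked by $\mathrm{LT}_\sigma$, i.e. $\mathrm{MT}_{\mathcal F}(f_i)=\mathrm{LT}_\sigma(f_i)$ for all $i$, and suppose that $\mathrm{LT}_\sigma(f_i)\notin\mathrm{Supp}(f_j)$ for $i\ne j$ and that $I=\langle\mathcal F\rangle_P$ is zero-dimensional. Apply the Border Basis Algorithm with Term Marking Strategy to $\mathcal F$, and assume that each time the Marked Interreduction is applied to a set $\{h_1,\ldots,h_r\}\subset P\setminus\{0\}$ during its execution, the set $\bigcup_{i=1}^r\mathrm{Supp}(h_i)=\{t_1,\ldots,t_l\}$ is enumerated in such a way that $t_1>_\sigma\cdots>_\sigma t_l$. Then the set of polynomials resulting from each such Marked Interreduction is marked according to $\mathrm{LT}_\sigma$, i.e. the marked term of each of its polynomials is the leading term of that polynomial with respect to $\sigma$, and the output of the Border Basis Algorithm with Term Marking Strategy is the $\mathcal O_\sigma\{I\}$-border basis of $I$.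
   Context: $\mathbb T^n=\{x_1^{\alpha_1}\cdots x_n^{\alpha_n}\mid\alpha_i\ge0\}$ is the set of terms. $\mathrm{Supp}(f)$ is the set of terms occurring in $f$ with nonzero coefficient; $\deg$ is total degree; $\langle\cdot\rangle_K$ is $K$-linear span. A term ordering $\sigma$ is degree compatible if $\deg(t)>\deg(t')$ implies $t>_\sigma t'$. $\mathrm{LT}_\sigma(f)$ is the leading term of $f$ with respect to $\sigma$, and $\mathcal O_\sigma\{I\}=\mathbb T^n\setminus\{\mathrm{LT}_\sigma(f)\mid f\in I\setminus\{0\}\}$. **Order ideals.** A set $\mathcal O\subseteq\mathbb T^n$ is an order ideal if it is closed under taking divisors. The order ideal spanned by a set of terms is the set of all divisors of these terms. Only finite order ideals are considered. The border is $\partial\mathcal O=(x_1\mathcal O\cup\cdots\cup x_n\mathcal O)\setminus\mathcal O$, with $\partial\emptyset=\{1\}$. For a set $F\subset P$, $F^+=F\cup x_1F\cup\cdots\cup x_nF$. **Border bases.** Let $\mathcal O=\{t_1,\dots,t_\mu\}$ be an order ideal with $\partial\mathcal O=\{b_1,\dots,b_\nu\}$. A set $G=\{g_1,\dots,g_\nu\}$ with $g_j=b_j-\sum_{i=1}^\mu\alpha_{ij}t_i$, $\alpha_{ij}\in K$, is an $\mathcal O$-border basis of an ideal $I\subseteq P$ if $G\subset I$ and the residue classes of $t_1,\dots,t_\mu$ form a $K$-basis of $P/I$ (it is then unique). **Markings.** A marking of $\mathcal F\subseteq P\setminus\{0\}$ is a mapping $\mathrm{MT}_{\mathcal F}$ on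 $\mathcal F$ with $\mathrm{MT}_{\mathcal F}(f)\in\mathrm{Supp}(f)$ and $\deg(\mathrm{MT}_{\mathcal F}(f))=\deg(f)$ for all $f\in\mathcal F$; $\mathrm{MT}_{\mathcal F}(f)$ is the marked term of $f$. For degree compatible $\sigma$, $\mathrm{LT}_\sigma$ is a marking of any $\mathcal F$. Subsets of marked sets inherit the marking. **Marked Interreduction.** Input: a list $f_1,\ldots,f_s$ of distinct nonzero marked polynomials. Enumerate $\bigcup_i\mathrm{Supp}(f_i)=\{t_1,\ldots,t_l\}$ with $\deg(t_1)\ge\cdots\ge\deg(t_l)$. (1) Write $f_i=\sum_ja_{ij}t_j$ with $a_{ij}\in K$. (2) Let $p_i$ be the index such that the marked term of $f_i$ is $t_{p_i}$. (3) For $i=1,\ldots,s$ perform (4)-(6). (4) If $a_{ip_i}\ne0$, multiply row $i$ of $(a_{ij})$ by $a_{ip_i}^{-1}$. (5) For each $k\in\{1,\ldots,s\}\setminus\{i\}$ with $a_{kp_i}\ne0$, subtract $a_{kp_i}$ times row $i$ from row $k$. (6) For each $k=i+1,\ldots,s$ with $a_{kp_k}=0$, let $j$ be the minimum column index with $a_{kj}\ne0$, if it exists, and set $p_k:=j$. (7) Return the set of all nonzero polynomials $\sum_ja_{ij}t_j$, $i=1,\ldots,s$, where the $i$-th one has marked term $t_{p_i}$. **Border Basis Algorithm with Term Marking Strategy.** Input: marked $\mathcal F=\{f_1,\ldots,f_s\}\subset P\setminus\{0\}$ with $\mathrm{MT}_{\mathcal F}(f_i)\notin\mathrm{Supp}(f_j)$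 for $i\ne j$, generating a zero-dimensional ideal. (T1) Let $\mathcal U$ be the order ideal spanned by $\bigcup_i\mathrm{Supp}(f_i)$. (T2) Apply the Marked Interreduction to $\{f_1,\ldots,f_s\}$ to obtain $\mathcal V$. (T3) a) Mark in all $x_iv\in\mathcal V^+\setminus\mathcal V$ ($1\le i\le n$, $v\in\mathcal V$) the term $x_it$ where $t$ is the marked term of $v$. b) Apply the Marked Interreduction to the elements of $\mathcal V$ followed by those of $\mathcal V^+\setminus\mathcal V$ to obtain $\tilde{\mathcal V}$. c) Let $T=\{\mathrm{MT}_{\mathcal V}(v)\mid v\in\mathcal V\}$, $\mathcal V'=\{\tilde f\in\tilde{\mathcal V}\mid\mathrm{MT}_{\tilde{\mathcal V}}(\tilde f)\in T\}$, $\mathcal W'=\tilde{\mathcal V}\setminus\mathcal V'$. (T4) Let $\mathcal W=\{w\in\mathcal W'\mid\mathrm{MT}_{\mathcal W'}(w)\in\mathcal U\}$. (T5) If $\bigcup_{w\in\mathcal W}\mathrm{Supp}(w)\nsubseteq\mathcal U$, replace $\mathcal U$ by the order ideal spanned by $\mathcal U$ and $\bigcup_{w\in\mathcal W}\mathrm{Supp}(w)$ and continue with (T4). (T6) If $\mathcal W\ne\emptyset$, replace $\mathcal V$ by $\mathcal V'\cup\mathcal W$ and continue with (T3). (T7) Let $\mathcal O=\mathcal U\setminus\{\mathrm{MT}_{\mathcal V}(v)\mid v\in\mathcal V\}$. If $\mathcal O$ is not an order ideal, stop with a failure message. (T8) If $\partial\mathcal O\nsubseteq\mathcal U$, replace $\mathcal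 U$ by $\mathcal U^+$ and continue with (T3). (T9) Select in $\mathcal V$ those $g_1,\ldots,g_\nu$ with $\mathrm{MT}_{\mathcal V}(g_i)\in\partial\mathcal O$. Output $\{g_1,\ldots,g_\nu\}$ with its marking and $\mathcal O$. *)

theory Defs
  imports Complex_Main "HOL-Library.Poly_Mapping" "HOL-Library.Extended_Nat"
begin

section \<open>Terms and polynomials\<close>

text \<open>
  The indeterminates are the elements of a finite type \<open>'x\<close> (so their number \<open>n = CARD('x)\<close> is an
  arbitrary positive integer). A term is its exponent vector, written additively: \<open>s + t\<close> is the
  product of two terms and \<open>0\<close> is the term 1. Multiplication of polynomials is the one of
  \<open>HOL-Library.Poly_Mapping\<close>, and \<open>Poly_Mapping.keys f\<close> is the support of \<open>f\<close>.
\<close>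

type_synonym 'x pterm = "'x \<Rightarrow>\<^sub>0 nat"
type_synonym ('x, 'k) mpoly = "'x pterm \<Rightarrow>\<^sub>0 'k"

definition var_term :: "'x \<Rightarrow> 'x pterm" where
  "var_term i = Poly_Mapping.single i 1"

definition monomial :: "'k::zero \<Rightarrow> 'x pterm \<Rightarrow> ('x, 'k) mpoly" where
  "monomial c t = Poly_Mapping.single t c"

definition var_poly :: "'x \<Rightarrow> ('x, 'k::field) mpoly" where
  "var_poly i = monomial 1 (var_term i)"

definition scale_poly :: "'k::field \<Rightarrow> ('x, 'k) mpoly \<Rightarrow> ('x, 'k) mpoly" where
  "scale_poly c f = monomial c 0 * f"

definition deg_term :: "'x::finite pterm \<Rightarrow> nat" where
  "deg_term t = (\<Sum>i\<in>UNIV. Poly_Mapping.lookup t i)"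

definition term_dvd :: "'x pterm \<Rightarrow> 'x pterm \<Rightarrow> bool" where
  "term_dvd s t \<longleftrightarrow> (\<exists>u. t = s + u)"

definition supp_set :: "('x, 'k::zero) mpoly set \<Rightarrow> 'x pterm set" where
  "supp_set F = (\<Union>f\<in>F. Poly_Mapping.keys f)"


section \<open>Ideals\<close>

interpretation ideal: module "(*) :: ('x, 'k::field) mpoly \<Rightarrow> _ \<Rightarrow> _"
  by unfold_locales (simp_all add: algebra_simps)

interpretation poly_vs: vector_space "scale_poly :: 'k::field \<Rightarrow> ('x, 'k) mpoly \<Rightarrow> _"
proof
  fix a b :: 'k and f g :: "('x, 'k) mpoly"
  show "scale_poly a (f + g) = scale_poly a f + scale_poly a g"
    by (simp add: scale_poly_def distrib_left)
  show "scale_poly (a + b) f = scale_poly a f + scale_poly b f"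
    by (simp add: scale_poly_def monomial_def single_add distrib_right)
  show "scale_poly a (scale_poly b f) = scale_poly (a * b) f"
    by (simp add: scale_poly_def monomial_def mult_single flip: mult.assoc)
  show "scale_poly 1 f = f"
    by (simp add: scale_poly_def monomial_def)
qed

abbreviation ideal_generated :: "('x, 'k::field) mpoly set \<Rightarrow> ('x, 'k) mpoly set" where
  "ideal_generated \<equiv> module.span (*)"

abbreviation K_span :: "('x, 'k::field) mpoly set \<Rightarrow> ('x, 'k) mpoly set" where
  "K_span \<equiv> module.span scale_poly"

text \<open>\<open>P/I\<close> is a finite-dimensional \<open>K\<close>-vector space; this includes \<open>I = P\<close>.\<close>

definition zero_dimensional :: "('x, 'k::field) mpoly set \<Rightarrow> bool" where
  "zero_dimensional I \<longleftrightarrow> (\<exists>B. finite B \<and> (\<forall>f. \<exists>g\<in>K_span B. f - g \<in> I))"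

text \<open>For finite \<open>S\<close>: the residue classes of the terms \<open>t \<in> S\<close> generate \<open>P/I\<close> as a \<open>K\<close>-vector space
  and are linearly independent.\<close>

definition residue_basis :: "'x pterm set \<Rightarrow> ('x, 'k::field) mpoly set \<Rightarrow> bool" where
  "residue_basis S I \<longleftrightarrow>
     (\<forall>f. \<exists>c. f - (\<Sum>t\<in>S. monomial (c t) t) \<in> I) \<and>
     (\<forall>c. (\<Sum>t\<in>S. monomial (c t) t) \<in> I \<longrightarrow> (\<forall>t\<in>S. c t = 0))"


section \<open>Term orderings\<close>

text \<open>\<open>(s, t) \<in> \<sigma>\<close> means \<open>s \<le>\<^sub>\<sigma> t\<close>. (For finitely many indeterminates the well-ordering property
  is a consequence of the following axioms.)\<close>

definition term_ordering :: "'x pterm rel \<Rightarrow> bool" where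
  "term_ordering \<sigma> \<longleftrightarrow> linear_order \<sigma> \<and> (\<forall>t. (0, t) \<in> \<sigma>) \<and>
     (\<forall>s t u. (s, t) \<in> \<sigma> \<longrightarrow> (s + u, t + u) \<in> \<sigma>)"

definition term_gt :: "'x pterm rel \<Rightarrow> 'x pterm \<Rightarrow> 'x pterm \<Rightarrow> bool" where
  "term_gt \<sigma> t t' \<longleftrightarrow> (t', t) \<in> \<sigma> \<and> t \<noteq> t'"

definition degree_compatible :: "'x::finite pterm rel \<Rightarrow> bool" where
  "degree_compatible \<sigma> \<longleftrightarrow> (\<forall>t t'. deg_term t > deg_term t' \<longrightarrow> term_gt \<sigma> t t')"

definition LT :: "'x pterm rel \<Rightarrow> ('x, 'k::zero) mpoly \<Rightarrow> 'x pterm" where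
  "LT \<sigma> f = (THE t. t \<in> Poly_Mapping.keys f \<and> (\<forall>s\<in>Poly_Mapping.keys f. (s, t) \<in> \<sigma>))"

definition LT_complement :: "'x pterm rel \<Rightarrow> ('x, 'k::zero) mpoly set \<Rightarrow> 'x pterm set" where
  "LT_complement \<sigma> I = UNIV - {LT \<sigma> f | f. f \<in> I - {0}}"


section \<open>Order ideals and border bases\<close>

definition order_ideal :: "'x pterm set \<Rightarrow> bool" where
  "order_ideal S \<longleftrightarrow> finite S \<and> (\<forall>t\<in>S. \<forall>s. term_dvd s t \<longrightarrow> s \<in> S)"

definition order_ideal_spanned :: "'x pterm set \<Rightarrow> 'x pterm set" where
  "order_ideal_spanned S = {s. \<exists>t\<in>S. term_dvd s t}"

definition terms_plus :: "'x pterm set \<Rightarrow> 'x pterm set" where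
  "terms_plus S = S \<union> (\<Union>i. (\<lambda>t. var_term i + t) ` S)"

definition polys_plus :: "('x, 'k::field) mpoly set \<Rightarrow> ('x, 'k) mpoly set" where
  "polys_plus F = F \<union> (\<Union>i. (\<lambda>f. var_poly i * f) ` F)"

definition border :: "'x pterm set \<Rightarrow> 'x pterm set" where
  "border S = (if S = {} then {0} else (\<Union>i. (\<lambda>t. var_term i + t) ` S) - S)"

definition is_border_basis ::
  "'x pterm set \<Rightarrow> ('x, 'k::field) mpoly set \<Rightarrow> ('x, 'k) mpoly set \<Rightarrow> bool" where
  "is_border_basis S G I \<longleftrightarrow> order_ideal S \<and>
     (\<exists>g \<alpha>. G = g ` border S \<and>
        (\<forall>b\<in>border S. g b = monomial 1 b - (\<Sum>t\<in>S. monomial (\<alpha> t b) t))) \<and>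
     G \<subseteq> I \<and> residue_basis S I"


section \<open>Marked Interreduction\<close>

text \<open>A marked polynomial is a pair of a polynomial and its marked term.\<close>

type_synonym ('x, 'k) marked = "('x, 'k) mpoly \<times> 'x pterm"

definition term_enumeration :: "('x::finite, 'k::zero) marked list \<Rightarrow> 'x pterm list \<Rightarrow> bool" where
  "term_enumeration hs ts \<longleftrightarrow> distinct ts \<and> set ts = supp_set (fst ` set hs) \<and>
     sorted_wrt (\<lambda>t t'. deg_term t \<ge> deg_term t') ts"

text \<open>Rows, columns and pivots are counted from 0. The state of the computation consists of the
  matrix \<open>A\<close> and the map \<open>p\<close> of pivot columns; \<open>s\<close> is the number of rows, \<open>l\<close> that of columns.
  Since row \<open>i\<close> does not change in step (5), all the other rows can be treated simultaneously,
  and likewise in step (6).\<close>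

definition mi_normalize ::
  "nat \<Rightarrow> (nat \<Rightarrow> nat \<Rightarrow> 'k::field) \<Rightarrow> (nat \<Rightarrow> nat) \<Rightarrow> (nat \<Rightarrow> nat \<Rightarrow> 'k)" where
  "mi_normalize i A p =
     (if A i (p i) \<noteq> 0 then A(i := (\<lambda>j. inverse (A i (p i)) * A i j)) else A)"

definition mi_eliminate ::
  "nat \<Rightarrow> nat \<Rightarrow> (nat \<Rightarrow> nat \<Rightarrow> 'k::field) \<Rightarrow> (nat \<Rightarrow> nat) \<Rightarrow> (nat \<Rightarrow> nat \<Rightarrow> 'k)" where
  "mi_eliminate s i A p =
     (\<lambda>k j. if k < s \<and> k \<noteq> i \<and> A k (p i) \<noteq> 0 then A k j - A k (p i) * A i j else A k j)"

definition mi_new_pivots ::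
  "nat \<Rightarrow> nat \<Rightarrow> nat \<Rightarrow> (nat \<Rightarrow> nat \<Rightarrow> 'k::field) \<Rightarrow> (nat \<Rightarrow> nat) \<Rightarrow> (nat \<Rightarrow> nat)" where
  "mi_new_pivots s l i A p =
     (\<lambda>k. if i < k \<and> k < s \<and> A k (p k) = 0 \<and> (\<exists>j<l. A k j \<noteq> 0)
          then (LEAST j. j < l \<and> A k j \<noteq> 0) else p k)"

definition mi_round ::
  "nat \<Rightarrow> nat \<Rightarrow> nat \<Rightarrow> (nat \<Rightarrow> nat \<Rightarrow> 'k::field) \<times> (nat \<Rightarrow> nat)
     \<Rightarrow> (nat \<Rightarrow> nat \<Rightarrow> 'k) \<times> (nat \<Rightarrow> nat)" where
  "mi_round s l i = (\<lambda>(A, p).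
     let A' = mi_eliminate s i (mi_normalize i A p) p in (A', mi_new_pivots s l i A' p))"

definition mi_init ::
  "('x, 'k::field) marked list \<Rightarrow> 'x pterm list \<Rightarrow> (nat \<Rightarrow> nat \<Rightarrow> 'k) \<times> (nat \<Rightarrow> nat)" where
  "mi_init hs ts =
     ((\<lambda>i j. Poly_Mapping.lookup (fst (hs ! i)) (ts ! j)),
      (\<lambda>i. THE j. j < length ts \<and> ts ! j = snd (hs ! i)))"

definition mi_final ::
  "('x, 'k::field) marked list \<Rightarrow> 'x pterm list \<Rightarrow> (nat \<Rightarrow> nat \<Rightarrow> 'k) \<times> (nat \<Rightarrow> nat)" where
  "mi_final hs ts = fold (mi_round (length hs) (length ts)) [0..<length hs] (mi_init hs ts)"

definition marked_interreduction ::
  "('x, 'k::field) marked list \<Rightarrow> 'x pterm list \<Rightarrow> ('x, 'k) marked set" where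
  "marked_interreduction hs ts =
     (let (A, p) = mi_final hs ts;
          row = (\<lambda>i. \<Sum>j<length ts. monomial (A i j) (ts ! j))
      in {(row i, ts ! p i) | i. i < length hs \<and> row i \<noteq> 0})"


section \<open>The Border Basis Algorithm with Term Marking Strategy\<close>

text \<open>
  The algorithm is a transition system, because the orders in which the elements of a set are
  passed to the Marked Interreduction, and the term enumerations used there, are not prescribed.
  A transition is labelled with the list of marked polynomials and the term enumeration of the
  Marked Interreduction performed in it, if any.

  The states are the points of control: the input of the algorithm, the begin of (T3) with
  \<open>\<V>\<close> and \<open>\<U>\<close>, the begin of (T4) with \<open>\<V>\<close>, \<open>\<U>\<close>, \<open>\<V>'\<close> and \<open>\<W>'\<close>, the begin of (T7) with \<open>\<V>\<close> and \<open>\<U>\<close>,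
  the stop with a failure message, and the output (marked polynomials and order ideal).
\<close>

datatype ('m, 't) bba_control =
    Input "'m set"
  | At_T3 "'m set" "'t set"
  | At_T4 "'m set" "'t set" "'m set" "'m set"
  | At_T7 "'m set" "'t set"
  | Failed
  | Output "'m set" "'t set"

type_synonym ('x, 'k) bba_state = "(('x, 'k) marked, 'x pterm) bba_control"
type_synonym ('x, 'k) bba_label = "(('x, 'k) marked list \<times> 'x pterm list) option"

text \<open>Step (T3a), for the list \<open>ys\<close> of the elements of \<open>\<V>\<^sup>+ \<setminus> \<V>\<close> in some order. If an element has
  several representations \<open>x\<^sub>i v\<close>, then the marking of any of them may be used.\<close>

definition marked_extension :: "('x, 'k::field) marked set \<Rightarrow> ('x, 'k) marked list \<Rightarrow> bool" where
  "marked_extension V ys \<longleftrightarrow> distinct (map fst ys) \<and>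
     fst ` set ys = polys_plus (fst ` V) - fst ` V \<and>
     (\<forall>(h, t')\<in>set ys. \<exists>(v, t)\<in>V. \<exists>i. h = var_poly i * v \<and> t' = var_term i + t)"

inductive bba_step ::
  "('x::finite, 'k::field) bba_state \<Rightarrow> ('x, 'k) bba_label \<Rightarrow> ('x, 'k) bba_state \<Rightarrow> bool" where
  T1_T2: "bba_step (Input F) (Some (hs, ts)) (At_T3 (marked_interreduction hs ts) U)"
    if "set hs = F" and "distinct (map fst hs)" and "term_enumeration hs ts"
      and "U = order_ideal_spanned (supp_set (fst ` F))"
| T3: "bba_step (At_T3 V U) (Some (xs @ ys, ts)) (At_T4 V U V' W')"
    if "set xs = V" and "distinct (map fst xs)" and "marked_extension V ys"
      and "term_enumeration (xs @ ys) ts"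
      and "V' = {f \<in> marked_interreduction (xs @ ys) ts. snd f \<in> snd ` V}"
      and "W' = marked_interreduction (xs @ ys) ts - V'"
| T4_T5: "bba_step (At_T4 V U V' W') None
            (At_T4 V (order_ideal_spanned (U \<union> supp_set (fst ` W))) V' W')"
    if "W = {w \<in> W'. snd w \<in> U}" and "\<not> supp_set (fst ` W) \<subseteq> U"
| T6_continue: "bba_step (At_T4 V U V' W') None (At_T3 (V' \<union> W) U)"
    if "W = {w \<in> W'. snd w \<in> U}" and "supp_set (fst ` W) \<subseteq> U" and "W \<noteq> {}"
| T6_exit: "bba_step (At_T4 V U V' W') None (At_T7 V U)"
    if "{w \<in> W'. snd w \<in> U} = {}"
| T7_failure: "bba_step (At_T7 V U) None Failed"
    if "\<not> order_ideal (U - snd ` V)"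
| T8: "bba_step (At_T7 V U) None (At_T3 V (terms_plus U))"
    if "S = U - snd ` V" and "order_ideal S" and "\<not> border S \<subseteq> U"
| T9: "bba_step (At_T7 V U) None (Output {g \<in> V. snd g \<in> border S} S)"
    if "S = U - snd ` V" and "order_ideal S" and "border S \<subseteq> U"

text \<open>A complete execution on the marked input \<open>F\<close>: it consists of \<open>N \<le> \<infinity>\<close> transitions, the \<open>k\<close>-th
  of them leading from \<open>St k\<close> to \<open>St (Suc k)\<close> with label \<open>Lb k\<close>, and if it is finite, no transition
  leaves its last state. Values of \<open>St\<close> and \<open>Lb\<close> beyond \<open>N\<close> are irrelevant.\<close>

definition bba_execution ::
  "('x::finite, 'k::field) marked set \<Rightarrow> enat \<Rightarrow> (nat \<Rightarrow> ('x, 'k) bba_state) \<Rightarrow>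
     (nat \<Rightarrow> ('x, 'k) bba_label) \<Rightarrow> bool" where
  "bba_execution F N St Lb \<longleftrightarrow> St 0 = Input F \<and>
     (\<forall>k. enat k < N \<longrightarrow> bba_step (St k) (Lb k) (St (Suc k))) \<and>
     (\<forall>k. N = enat k \<longrightarrow> (\<nexists>lb s. bba_step (St k) lb s))"

definition bba_output ::
  "enat \<Rightarrow> (nat \<Rightarrow> ('x, 'k::field) bba_state) \<Rightarrow> ('x, 'k) marked set \<Rightarrow> 'x pterm set \<Rightarrow> bool" where
  "bba_output N St G S \<longleftrightarrow> (\<exists>m. N = enat m \<and> St m = Output G S)"

end

theory Submission
  imports Defs
begin

text \<open>
  Everything rests on reading the Marked Interreduction as Gauss-Jordan elimination. If the marked
  terms of the input are its leading terms and the columns are sorted decreasingly with respect to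
  \<open>\<sigma>\<close>, then the marked positions are the leading positions of the rows. This stays true in every
  round, so the result is the reduced row echelon form of the span of the input, marked by leading
  terms (\<open>marked_interreduction_reduced\<close>). Leading terms are compatible with multiplication by an
  indeterminate, so step (T3a) marks leading terms too. Hence all marked sets of an execution are
  determined by reduced sets \<open>G\<close> of polynomials, and the leading terms of the nonzero elements of the
  span of \<open>G\<close> are exactly those of the elements of \<open>G\<close>.

  At (T7) the set \<open>G\<close> is stable: an element of the span of \<open>G\<^sup>+\<close> whose leading term is in \<open>U\<close> has the
  leading term of an element of \<open>G\<close>. Therefore the leading terms of \<open>G\<close> are closed under multiples
  within \<open>U\<close>, their complement \<open>S\<close> in \<open>U\<close> is an order ideal, and the failure in (T7) does not occur.
  If the border of \<open>S\<close> is contained in \<open>U\<close>, then taking normal forms of products with the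
  indeterminates gives operators on the span of \<open>S\<close>, which commute because \<open>G\<close> is stable. They make
  the span of \<open>S\<close> a module over the polynomial ring, and letting a polynomial act on the residue
  class of 1 is a linear map that vanishes on the ideal and is the identity on the span of \<open>S\<close>
  (\<open>stable_ideal_normal_form\<close>). So no nonzero element of the ideal is supported in \<open>S\<close>. Each term
  outside of \<open>S\<close> is a multiple of a border term, hence a leading term of the ideal. Together this
  identifies \<open>S\<close> with \<open>\<O>\<^sub>\<sigma>{I}\<close> and makes its residue classes a basis (\<open>stable_border_basis\<close>).

  For termination, (T5) does not raise the maximal degree of \<open>U\<close>, because \<open>\<sigma>\<close> is degree compatible,
  so between two executions of (T8) there are only finitely many terms to be added to \<open>U\<close> in (T5) or
  to the leading terms of \<open>G\<close> in (T6). The number of executions of (T8) is bounded: as the ideal is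
  zero-dimensional, finitely many of its elements have all terms of a certain degree as leading
  terms, and a stable set whose \<open>U\<close> contains all terms up to a large degree \<open>D\<close> has them all in its
  span (\<open>border_bound\<close>). The measure that combines these observations decreases in every transition
  (\<open>bba_step_decreases\<close>).
\<close>

section \<open>Terms and coefficients\<close>

lemma lookup_monomial: "Poly_Mapping.lookup (monomial c t) s = (if s = t then c else 0)"
  by (auto simp: monomial_def lookup_single when_def)

lemma monomial_zero [simp]: "monomial 0 t = 0"
  by (simp add: monomial_def)

lemma keys_monomial: "Poly_Mapping.keys (monomial c t) = (if c = 0 then {} else {t})"
  by (simp add: monomial_def)

lemma monomial_add: "monomial (a + b) t = monomial a t + monomial b t"
  by (simp add: monomial_def single_add)

lemma monomial_mult: "monomial a s * monomial b t = monomial (a * b) (s + t)"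
  by (simp add: monomial_def mult_single)

lemma scale_monomial: "scale_poly c (monomial a t) = monomial (c * a) t"
  by (simp add: scale_poly_def monomial_mult)

lemma poly_eq_sum_monomials:
  "f = (\<Sum>t\<in>Poly_Mapping.keys f. monomial (Poly_Mapping.lookup f t) t)"
  by (rule poly_mapping_eqI) (auto simp: lookup_sum lookup_monomial in_keys_iff)

lemma poly_eq_sum_monomials_superset:
  assumes "finite A" and "Poly_Mapping.keys f \<subseteq> A"
  shows "f = (\<Sum>t\<in>A. monomial (Poly_Mapping.lookup f t) t)"
  by (subst poly_eq_sum_monomials, rule sum.mono_neutral_left)
    (use assms in \<open>auto simp: in_keys_iff\<close>)

lemma lookup_monomial_times:
  "Poly_Mapping.lookup (monomial c u * f) (u + t) = c * Poly_Mapping.lookup f t"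
proof -
  have "monomial c u * f = (\<Sum>s\<in>Poly_Mapping.keys f. monomial (c * Poly_Mapping.lookup f s) (u + s))"
    by (subst poly_eq_sum_monomials[of f]) (simp add: sum_distrib_left monomial_mult)
  then have "Poly_Mapping.lookup (monomial c u * f) (u + t)
      = (\<Sum>s\<in>Poly_Mapping.keys f. if s = t then c * Poly_Mapping.lookup f s else 0)"
    by (simp add: lookup_sum lookup_monomial eq_commute[of t])
  then show ?thesis
    by (auto simp: in_keys_iff)
qed

lemma keys_monomial_times_subset:
  "Poly_Mapping.keys (monomial c u * f) \<subseteq> (+) u ` Poly_Mapping.keys f"
  using keys_mult[of "monomial c u" f] by (auto simp: keys_monomial split: if_splits)

lemma lookup_scale: "Poly_Mapping.lookup (scale_poly c f) t = c * Poly_Mapping.lookup f t"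
  unfolding scale_poly_def using lookup_monomial_times[of c 0 f t] by simp

lemma keys_scale_subset: "Poly_Mapping.keys (scale_poly c f) \<subseteq> Poly_Mapping.keys f"
  by (auto simp: in_keys_iff lookup_scale)

lemma scale_poly_mult: "h * scale_poly c f = scale_poly c (h * f)"
  by (simp add: scale_poly_def mult.left_commute)

lemma keys_minus_subset:
  "Poly_Mapping.keys (f - g) \<subseteq> Poly_Mapping.keys f \<union> Poly_Mapping.keys (g :: _ \<Rightarrow>\<^sub>0 _ :: ab_group_add)"
  by (auto simp: in_keys_iff lookup_minus)

lemma keys_sum_subset:
  "Poly_Mapping.keys (\<Sum>i\<in>A. f i) \<subseteq> (\<Union>i\<in>A. Poly_Mapping.keys (f i))"
proof
  fix t assume "t \<in> Poly_Mapping.keys (\<Sum>i\<in>A. f i)"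
  then have "(\<Sum>i\<in>A. Poly_Mapping.lookup (f i) t) \<noteq> 0"
    by (simp add: in_keys_iff lookup_sum)
  then obtain i where "i \<in> A" "Poly_Mapping.lookup (f i) t \<noteq> 0"
    by (meson sum.neutral)
  then show "t \<in> (\<Union>i\<in>A. Poly_Mapping.keys (f i))"
    by (auto simp: in_keys_iff)
qed

lemma keys_K_span: "f \<in> K_span F \<Longrightarrow> Poly_Mapping.keys f \<subseteq> supp_set F"
proof (induction rule: poly_vs.span_induct_alt)
  case (step c x y)
  then show ?case
    using keys_add[of "scale_poly c x" y] keys_scale_subset[of c x] by (auto simp: supp_set_def)
qed simp

lemma lookup_var_times:
  "Poly_Mapping.lookup (var_poly i * f) (var_term i + t) = Poly_Mapping.lookup f t"
  by (simp add: var_poly_def lookup_monomial_times)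

lemma keys_var_times:
  "Poly_Mapping.keys (var_poly i * f) = (\<lambda>t. var_term i + t) ` Poly_Mapping.keys f"
proof
  show "Poly_Mapping.keys (var_poly i * f) \<subseteq> (\<lambda>t. var_term i + t) ` Poly_Mapping.keys f"
    unfolding var_poly_def by (rule keys_monomial_times_subset)
qed (auto simp: in_keys_iff lookup_var_times)

lemma var_times_eq_0_iff: "var_poly i * f = 0 \<longleftrightarrow> f = 0"
  using keys_var_times[of i f] by (metis image_is_empty keys_eq_empty)

lemma deg_term_zero [simp]: "deg_term 0 = 0"
  by (simp add: deg_term_def)

lemma deg_term_add: "deg_term (s + t) = deg_term s + deg_term t"
  by (simp add: deg_term_def lookup_add sum.distrib)

lemma deg_var_term [simp]: "deg_term (var_term i) = 1"
  by (simp add: deg_term_def var_term_def lookup_single when_def)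

lemma deg_term_dvd: "term_dvd s t \<Longrightarrow> deg_term s \<le> deg_term t"
  by (auto simp: term_dvd_def deg_term_add)

lemma deg_term_eq_0_iff [simp]: "deg_term t = 0 \<longleftrightarrow> t = 0"
  by (auto simp: deg_term_def intro: poly_mapping_eqI)

lemma infinite_terms: "\<not> finite (UNIV :: 'x::finite pterm set)"
proof
  assume fin: "finite (UNIV :: 'x::finite pterm set)"
  have "\<exists>t :: 'x::finite pterm. deg_term t = n" for n
  proof (induction n)
    case (Suc n)
    then obtain t :: "'x::finite pterm" where "deg_term t = n" by blast
    then show ?case by (intro exI[of _ "var_term i + t" for i]) (simp add: deg_term_add)
  qed (intro exI[of _ 0], simp)
  then obtain t :: "'x::finite pterm" where "deg_term t = Suc (Max (range (deg_term :: 'x::finite pterm \<Rightarrow> nat)))"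
    by blast
  moreover have "deg_term t \<le> Max (range (deg_term :: 'x::finite pterm \<Rightarrow> nat))"
    using fin by simp
  ultimately show False by simp
qed

lemma term_dvd_refl [simp]: "term_dvd t t"
  by (auto simp: term_dvd_def intro: exI[of _ 0])

lemma term_dvd_trans: "term_dvd s t \<Longrightarrow> term_dvd t u \<Longrightarrow> term_dvd s u"
  by (auto simp: term_dvd_def add.assoc)

lemma term_dvd_zero [simp]: "term_dvd 0 t"
  by (simp add: term_dvd_def)

lemma term_dvd_add_left [simp]: "term_dvd t (s + t)" "term_dvd s (s + t)"
  by (auto simp: term_dvd_def add.commute)

lemma term_eq_var_term_add:
  assumes "t \<noteq> (0 :: 'x pterm)"
  obtains i s where "t = var_term i + s"
proof -
  from assms obtain i where i: "Poly_Mapping.lookup t i \<noteq> 0"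
    by (metis lookup_zero poly_mapping_eqI)
  then have "t = var_term i + (t - var_term i)"
    by (intro poly_mapping_eqI) (auto simp: lookup_add lookup_minus var_term_def lookup_single when_def)
  then show thesis by (rule that)
qed

lemma term_induct [case_names zero var]:
  assumes "P (0 :: 'x::finite pterm)" and "\<And>i t. P t \<Longrightarrow> P (var_term i + t)"
  shows "P t"
proof (induction "deg_term t" arbitrary: t)
  case 0
  then show ?case using assms(1) by simp
next
  case (Suc d)
  then have "t \<noteq> 0" by auto
  then obtain i s where "t = var_term i + s" by (rule term_eq_var_term_add)
  then show ?case using Suc assms(2) by (simp add: deg_term_add)
qed

definition terms_upto :: "nat \<Rightarrow> 'x::finite pterm set" where
  "terms_upto d = {t. deg_term t \<le> d}"

lemma terms_plus_upto: "terms_plus (terms_upto d) = terms_upto (Suc d)"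
proof
  show "terms_plus (terms_upto d) \<subseteq> (terms_upto (Suc d) :: 'x::finite pterm set)"
    by (auto simp: terms_plus_def terms_upto_def deg_term_add)
  show "terms_upto (Suc d) \<subseteq> (terms_plus (terms_upto d) :: 'x::finite pterm set)"
  proof
    fix t :: "'x::finite pterm"
    assume t: "t \<in> terms_upto (Suc d)"
    show "t \<in> terms_plus (terms_upto d)"
    proof (cases "t = 0")
      case False
      then obtain i s where "t = var_term i + s" by (rule term_eq_var_term_add)
      with t show ?thesis
        by (auto simp: terms_plus_def terms_upto_def deg_term_add)
    qed (auto simp: terms_plus_def terms_upto_def)
  qed
qed

lemma finite_terms_plus: "finite S \<Longrightarrow> finite (terms_plus (S :: 'x::finite pterm set))"
  by (simp add: terms_plus_def)

lemma finite_terms_upto [simp]: "finite (terms_upto d :: 'x::finite pterm set)"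
proof (induction d)
  case 0
  have "terms_upto 0 = {0 :: 'x pterm}" by (auto simp: terms_upto_def)
  then show ?case by simp
next
  case (Suc d)
  then show ?case using finite_terms_plus[of "terms_upto d"] by (simp add: terms_plus_upto)
qed

lemma order_ideal_spanned_superset: "S \<subseteq> order_ideal_spanned S"
  unfolding order_ideal_spanned_def using term_dvd_refl by blast

lemma order_ideal_spanned_subset_upto:
  "S \<subseteq> terms_upto d \<Longrightarrow> order_ideal_spanned S \<subseteq> terms_upto d"
  using deg_term_dvd by (fastforce simp: order_ideal_spanned_def terms_upto_def)

lemma order_ideal_order_ideal_spanned:
  assumes "finite (S :: 'x::finite pterm set)"
  shows "order_ideal (order_ideal_spanned S)"
proof -
  have "S \<subseteq> terms_upto (Max (deg_term ` S))"
    using assms by (auto simp: terms_upto_def)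
  then have "finite (order_ideal_spanned S)"
    by (meson finite_subset finite_terms_upto order_ideal_spanned_subset_upto)
  then show ?thesis
    by (auto simp: order_ideal_def order_ideal_spanned_def intro: term_dvd_trans)
qed

lemma order_ideal_terms_plus:
  assumes "order_ideal (U :: 'x::finite pterm set)"
  shows "order_ideal (terms_plus U)"
  unfolding order_ideal_def
proof (intro conjI ballI allI impI)
  show "finite (terms_plus U)"
    using assms by (simp add: order_ideal_def finite_terms_plus)
next
  fix t s assume t: "t \<in> terms_plus U" and st: "term_dvd s t"
  show "s \<in> terms_plus U"
  proof (cases "t \<in> U")
    case True
    then show ?thesis using assms st by (auto simp: order_ideal_def terms_plus_def)
  next
    case False
    with t obtain i u where u: "t = var_term i + u" "u \<in> U" by (auto simp: terms_plus_def)
    from st obtain v where v: "t = s + v" by (auto simp: term_dvd_def)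
    show ?thesis
    proof (cases "Poly_Mapping.lookup s i = 0")
      case True
      have "Poly_Mapping.lookup s j \<le> Poly_Mapping.lookup u j" for j
      proof (cases "j = i")
        case False
        have "Poly_Mapping.lookup (s + v) j = Poly_Mapping.lookup (var_term i + u) j"
          using u v by simp
        then show ?thesis using False
          by (simp add: lookup_add var_term_def lookup_single when_def split: if_splits)
      qed (simp add: True)
      then have "u = s + (u - s)"
        by (intro poly_mapping_eqI) (simp add: lookup_add lookup_minus)
      then have "term_dvd s u" by (auto simp: term_dvd_def)
      then show ?thesis using u assms by (auto simp: order_ideal_def terms_plus_def)
    next
      case False
      then have s: "s = var_term i + (s - var_term i)"
        by (intro poly_mapping_eqI) (auto simp: lookup_add lookup_minus var_term_def lookup_single when_def)
      then have "var_term i + u = var_term i + ((s - var_term i) + v)"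
        using u v by (metis add.assoc)
      then have "term_dvd (s - var_term i) u" by (auto simp: term_dvd_def)
      then have "s - var_term i \<in> U" using u assms by (auto simp: order_ideal_def)
      then show ?thesis using s by (force simp: terms_plus_def)
    qed
  qed
qed

lemma dvd_border:
  assumes S: "order_ideal S" and t: "t \<notin> S"
  shows "\<exists>b\<in>border S. term_dvd b (t :: 'x::finite pterm)"
  using t
proof (induction t rule: term_induct)
  case zero
  then have "S = {}" using S by (auto simp: order_ideal_def)
  then show ?case by (simp add: border_def)
next
  case (var i t)
  show ?case
  proof (cases "t \<in> S")
    case True
    then show ?thesis using var.prems by (intro bexI[of _ "var_term i + t"]) (auto simp: border_def)
  next
    case False
    then show ?thesis using var.IH term_dvd_add_left term_dvd_trans by blast
  qed
qed

lemma polys_plus_var: "f \<in> F \<Longrightarrow> var_poly i * f \<in> polys_plus F"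
  by (auto simp: polys_plus_def)

lemma polys_plus_superset: "F \<subseteq> polys_plus F"
  by (auto simp: polys_plus_def)

lemma finite_polys_plus: "finite F \<Longrightarrow> finite (polys_plus F :: ('x::finite, 'k::field) mpoly set)"
  by (simp add: polys_plus_def)

lemma var_times_K_span: "f \<in> K_span F \<Longrightarrow> var_poly i * f \<in> K_span (polys_plus F)"
proof (induction rule: poly_vs.span_induct_alt)
  case (step c x y)
  then show ?case
    by (simp add: distrib_left scale_poly_mult poly_vs.span_add poly_vs.span_scale
        poly_vs.span_base polys_plus_var)
qed (simp add: poly_vs.span_zero)

lemma K_span_subset_ideal: "F \<subseteq> ideal_generated G \<Longrightarrow> K_span F \<subseteq> ideal_generated G"
proof
  fix f assume F: "F \<subseteq> ideal_generated G" and "f \<in> K_span F"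
  from this(2) show "f \<in> ideal_generated G"
  proof (induction rule: poly_vs.span_induct_alt)
    case (step c x y)
    then show ?case using F unfolding scale_poly_def
      by (intro ideal.span_add ideal.span_scale) auto
  qed (rule ideal.span_zero)
qed

lemma polys_plus_subset_ideal: "F \<subseteq> ideal_generated G \<Longrightarrow> polys_plus F \<subseteq> ideal_generated G"
  by (auto simp: polys_plus_def intro: ideal.span_scale)

lemma ex_divisor_of_degree: "d \<le> deg_term t \<Longrightarrow> \<exists>s. term_dvd s t \<and> deg_term s = d"
proof (induction t rule: term_induct)
  case zero
  then show ?case by (intro exI[of _ 0]) simp
next
  case (var i t)
  show ?case
  proof (cases "d \<le> deg_term t")
    case True
    then show ?thesis using var.IH term_dvd_trans term_dvd_add_left(1) by blast
  next
    case False
    then show ?thesis using var.prems by (intro exI[of _ "var_term i + t"]) (simp add: deg_term_add)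
  qed
qed

lemma terms_upto_mono: "d \<le> e \<Longrightarrow> terms_upto d \<subseteq> terms_upto e"
  by (auto simp: terms_upto_def)

lemma border_subset_upto:
  assumes "S \<subseteq> terms_upto d" shows "border S \<subseteq> terms_upto (Suc d)"
proof -
  have "border S \<subseteq> insert 0 (terms_plus S)" by (auto simp: border_def terms_plus_def)
  moreover have "terms_plus S \<subseteq> terms_plus (terms_upto d)" using assms by (auto simp: terms_plus_def)
  moreover have "0 \<in> terms_upto (Suc d)" by (simp add: terms_upto_def)
  ultimately show ?thesis unfolding terms_plus_upto by blast
qed

lemma keys_sum_monomials: "Poly_Mapping.keys (\<Sum>t\<in>A. monomial (c t) t) \<subseteq> A"
  by (rule order_trans[OF keys_sum_subset]) (auto simp: keys_monomial split: if_splits)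

lemma lookup_sum_monomials:
  "finite A \<Longrightarrow> Poly_Mapping.lookup (\<Sum>t\<in>A. monomial (c t) t) s = (if s \<in> A then c s else 0)"
  by (simp add: lookup_sum lookup_monomial)

section \<open>Leading terms and reduced sets\<close>

locale degree_ordering =
  fixes \<sigma> :: "'x::finite pterm rel"
  assumes ord: "term_ordering \<sigma>" and deg: "degree_compatible \<sigma>"
begin

lemma le_refl [simp]: "(t, t) \<in> \<sigma>"
  using ord by (auto simp: term_ordering_def linear_order_on_def partial_order_on_def
      preorder_on_def refl_on_def)

lemma le_trans: "(s, t) \<in> \<sigma> \<Longrightarrow> (t, u) \<in> \<sigma> \<Longrightarrow> (s, u) \<in> \<sigma>"
  using ord by (auto simp: term_ordering_def linear_order_on_def partial_order_on_def
      preorder_on_def dest: transD)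

lemma le_antisym: "(s, t) \<in> \<sigma> \<Longrightarrow> (t, s) \<in> \<sigma> \<Longrightarrow> s = t"
  using ord by (auto simp: term_ordering_def linear_order_on_def partial_order_on_def
      dest: antisymD)

lemma le_linear: "(s, t) \<in> \<sigma> \<or> (t, s) \<in> \<sigma>"
  using ord by (cases "s = t") (auto simp: term_ordering_def linear_order_on_def total_on_def)

lemma le_add: "(s, t) \<in> \<sigma> \<Longrightarrow> (u + s, u + t) \<in> \<sigma>"
  using ord by (auto simp: term_ordering_def add.commute)

lemma le_deg: "(s, t) \<in> \<sigma> \<Longrightarrow> deg_term s \<le> deg_term t"
  using deg le_antisym by (force simp: degree_compatible_def term_gt_def not_le[symmetric])

text \<open>A degree compatible ordering has only finitely many terms below a given one, as these have
  bounded degree. The number of terms below \<open>t\<close> therefore serves as a measure for induction along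
  the ordering.\<close>

definition rank :: "'x pterm \<Rightarrow> nat" where
  "rank t = card {s. (s, t) \<in> \<sigma>}"

lemma rank_less:
  assumes "(s, t) \<in> \<sigma>" and "s \<noteq> t"
  shows "rank s < rank t"
  unfolding rank_def
proof (rule psubset_card_mono)
  show "finite {u. (u, t) \<in> \<sigma>}"
    by (rule finite_subset[OF _ finite_terms_upto[of "deg_term t"]])
      (auto simp: terms_upto_def dest: le_deg)
  show "{u. (u, s) \<in> \<sigma>} \<subset> {u. (u, t) \<in> \<sigma>}"
  proof
    show "{u. (u, s) \<in> \<sigma>} \<subseteq> {u. (u, t) \<in> \<sigma>}"
      using assms(1) le_trans by blast
    have "(t, s) \<notin> \<sigma>" using assms le_antisym by blast
    then show "{u. (u, s) \<in> \<sigma>} \<noteq> {u. (u, t) \<in> \<sigma>}"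
      using le_refl[of t] by blast
  qed
qed

lemma LT_eqI:
  assumes "t \<in> Poly_Mapping.keys f" and "\<And>s. s \<in> Poly_Mapping.keys f \<Longrightarrow> (s, t) \<in> \<sigma>"
  shows "LT \<sigma> f = t"
  unfolding LT_def using assms le_antisym by (intro the_equality) blast+

lemma ex_greatest:
  assumes "finite A" and "A \<noteq> {}"
  shows "\<exists>t\<in>A. \<forall>s\<in>A. (s, t) \<in> \<sigma>"
  using assms
proof (induction A rule: finite_ne_induct)
  case (insert a A)
  then show ?case by (metis insert_iff le_linear le_refl le_trans)
qed simp

lemma LT_in_keys: "f \<noteq> 0 \<Longrightarrow> LT \<sigma> f \<in> Poly_Mapping.keys f"
  and LT_max: "s \<in> Poly_Mapping.keys f \<Longrightarrow> (s, LT \<sigma> f) \<in> \<sigma>"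
proof -
  have "LT \<sigma> f \<in> Poly_Mapping.keys f \<and> (\<forall>s\<in>Poly_Mapping.keys f. (s, LT \<sigma> f) \<in> \<sigma>)" if "f \<noteq> 0"
    using ex_greatest[of "Poly_Mapping.keys f"] that LT_eqI by (metis finite_keys keys_eq_empty)
  then show "f \<noteq> 0 \<Longrightarrow> LT \<sigma> f \<in> Poly_Mapping.keys f"
    and "s \<in> Poly_Mapping.keys f \<Longrightarrow> (s, LT \<sigma> f) \<in> \<sigma>" by (blast, cases "f = 0") auto
qed

lemma LT_monomial_times:
  assumes "f \<noteq> 0" and "c \<noteq> (0 :: 'k::field)"
  shows "LT \<sigma> (monomial c u * f) = u + LT \<sigma> f"
proof (rule LT_eqI)
  show "u + LT \<sigma> f \<in> Poly_Mapping.keys (monomial c u * f)"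
    using LT_in_keys[OF assms(1)] assms(2) by (simp add: in_keys_iff lookup_monomial_times)
  fix s assume "s \<in> Poly_Mapping.keys (monomial c u * f)"
  then show "(s, u + LT \<sigma> f) \<in> \<sigma>"
    using keys_monomial_times_subset[of c u f] LT_max le_add by blast
qed

lemma LT_var_times: "f \<noteq> 0 \<Longrightarrow> LT \<sigma> (var_poly i * f) = var_term i + LT \<sigma> f"
  unfolding var_poly_def by (rule LT_monomial_times) simp_all

lemma keys_subset_upto_LT: "Poly_Mapping.keys f \<subseteq> terms_upto (deg_term (LT \<sigma> f))"
  by (auto simp: terms_upto_def dest: LT_max le_deg)

text \<open>This is the reduced row echelon form, for columns sorted decreasingly with respect to \<open>\<sigma>\<close>.\<close>

definition reduced :: "('x, 'k::field) mpoly set \<Rightarrow> bool" where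
  "reduced G \<longleftrightarrow> finite G \<and>
     (\<forall>g\<in>G. g \<noteq> 0 \<and> Poly_Mapping.lookup g (LT \<sigma> g) = 1) \<and>
     (\<forall>f\<in>G. \<forall>g\<in>G. f \<noteq> g \<longrightarrow> LT \<sigma> f \<notin> Poly_Mapping.keys g)"

definition mark :: "('x, 'k::field) mpoly \<Rightarrow> ('x, 'k) marked" where
  "mark f = (f, LT \<sigma> f)"

lemma fst_mark [simp]: "fst (mark f) = f" and snd_mark [simp]: "snd (mark f) = LT \<sigma> f"
  by (simp_all add: mark_def)

lemma fst_image_mark [simp]: "fst ` mark ` G = G" and snd_image_mark [simp]: "snd ` mark ` G = LT \<sigma> ` G"
  by (simp_all add: image_image)

lemma reduced_subset: "reduced G \<Longrightarrow> H \<subseteq> G \<Longrightarrow> reduced H"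
  unfolding reduced_def by (meson finite_subset subsetD)

lemma reduced_LT_inj: "reduced G \<Longrightarrow> f \<in> G \<Longrightarrow> g \<in> G \<Longrightarrow> LT \<sigma> f = LT \<sigma> g \<Longrightarrow> f = g"
  using LT_in_keys unfolding reduced_def by metis

lemma reduced_lookup:
  assumes "reduced G" and "f \<in> G" and "g \<in> G"
  shows "Poly_Mapping.lookup f (LT \<sigma> g) = (if f = g then 1 else 0)"
  using assms unfolding reduced_def by (auto simp: in_keys_iff)

text \<open>As a leading term of \<open>G\<close> occurs in no other element of \<open>G\<close>, the coordinates of an element
  of the span can be read off at the leading terms.\<close>

lemma reduced_expansion:
  assumes G: "reduced G" and f: "f \<in> K_span G"
  shows "f = (\<Sum>g\<in>G. scale_poly (Poly_Mapping.lookup f (LT \<sigma> g)) g)"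
proof -
  have fin: "finite G" using G by (simp add: reduced_def)
  then obtain c where c: "f = (\<Sum>g\<in>G. scale_poly (c g) g)"
    using f by (auto simp: poly_vs.span_finite)
  have "Poly_Mapping.lookup f (LT \<sigma> g) = c g" if g: "g \<in> G" for g
  proof -
    have "Poly_Mapping.lookup f (LT \<sigma> g) = (\<Sum>h\<in>G. c h * (if h = g then 1 else 0))"
      using g reduced_lookup[OF G] by (simp add: c lookup_sum lookup_scale)
    then show ?thesis using fin g by (simp add: if_distrib cong: if_cong)
  qed
  then show ?thesis by (simp add: c)
qed

text \<open>The leading terms of the elements of an echelon form are distinct and cannot cancel each
  other.\<close>

lemma reduced_LT_span:
  assumes G: "reduced G" and f: "f \<in> K_span G" "f \<noteq> 0"
  shows "LT \<sigma> f \<in> LT \<sigma> ` G"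
proof -
  have "LT \<sigma> f \<in> Poly_Mapping.keys (\<Sum>g\<in>G. scale_poly (Poly_Mapping.lookup f (LT \<sigma> g)) g)"
    using LT_in_keys[OF f(2)] reduced_expansion[OF G f(1)] by simp
  then have "LT \<sigma> f \<in> (\<Union>g\<in>G. Poly_Mapping.keys (scale_poly (Poly_Mapping.lookup f (LT \<sigma> g)) g))"
    using keys_sum_subset by (rule rev_subsetD)
  then obtain g where g: "g \<in> G" "Poly_Mapping.lookup f (LT \<sigma> g) \<noteq> 0" "LT \<sigma> f \<in> Poly_Mapping.keys g"
    by (auto simp: in_keys_iff lookup_scale)
  then have "(LT \<sigma> g, LT \<sigma> f) \<in> \<sigma>" "(LT \<sigma> f, LT \<sigma> g) \<in> \<sigma>"
    by (auto intro: LT_max simp: in_keys_iff)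
  then show ?thesis using g(1) le_antisym by blast
qed

text \<open>For a reduced set \<open>G\<close>, this is the linear projection along the span of \<open>G\<close> onto the
  polynomials without leading terms of \<open>G\<close> in their support. Defining it by a formula makes it total,
  so that no subspace has to be fixed.\<close>

definition NF :: "('x, 'k::field) mpoly set \<Rightarrow> ('x, 'k) mpoly \<Rightarrow> ('x, 'k) mpoly" where
  "NF G f = f - (\<Sum>g\<in>G. scale_poly (Poly_Mapping.lookup f (LT \<sigma> g)) g)"

lemma NF_add: "NF G (f + g) = NF G f + NF G g"
  by (simp add: NF_def lookup_add poly_vs.scale_left_distrib sum.distrib)

lemma NF_scale: "NF G (scale_poly c f) = scale_poly c (NF G f)"
  unfolding NF_def poly_vs.scale_right_diff_distrib poly_vs.scale_sum_right poly_vs.scale_scale lookup_scale ..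

lemma NF_zero [simp]: "NF G 0 = 0"
  by (simp add: NF_def)

lemma NF_diff: "NF G (f - g) = NF G f - NF G g"
  using NF_add[of G "f - g" g] by simp

lemma diff_NF_in_span: "f - NF G f \<in> K_span G"
  by (simp add: NF_def poly_vs.span_sum poly_vs.span_scale poly_vs.span_base)

lemma NF_eq_0_iff:
  assumes "reduced G" shows "NF G f = 0 \<longleftrightarrow> f \<in> K_span G"
proof
  assume "NF G f = 0"
  then show "f \<in> K_span G" using diff_NF_in_span[of f G] by simp
next
  assume "f \<in> K_span G"
  then show "NF G f = 0" unfolding NF_def using reduced_expansion[OF assms] by simp
qed

lemma keys_NF:
  assumes G: "reduced G" and f: "Poly_Mapping.keys f \<subseteq> U" and U: "supp_set G \<subseteq> U"
  shows "Poly_Mapping.keys (NF G f) \<subseteq> U - LT \<sigma> ` G"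
proof
  fix t assume t: "t \<in> Poly_Mapping.keys (NF G f)"
  have "Poly_Mapping.keys (NF G f) \<subseteq> U"
  proof -
    have "Poly_Mapping.keys (\<Sum>g\<in>G. scale_poly (Poly_Mapping.lookup f (LT \<sigma> g)) g) \<subseteq> supp_set G"
      by (rule order_trans[OF keys_sum_subset])
        (auto simp: supp_set_def dest: subsetD[OF keys_scale_subset])
    then show ?thesis
      unfolding NF_def using f U by (intro order_trans[OF keys_minus_subset]) blast
  qed
  moreover have "Poly_Mapping.lookup (NF G f) (LT \<sigma> g) = 0" if g: "g \<in> G" for g
  proof -
    have "Poly_Mapping.lookup (\<Sum>h\<in>G. scale_poly (Poly_Mapping.lookup f (LT \<sigma> h)) h) (LT \<sigma> g)
        = (\<Sum>h\<in>G. Poly_Mapping.lookup f (LT \<sigma> h) * (if h = g then 1 else 0))"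
      using g reduced_lookup[OF G] by (simp add: lookup_sum lookup_scale)
    then show ?thesis using g G by (simp add: NF_def lookup_minus reduced_def if_distrib cong: if_cong)
  qed
  ultimately show "t \<in> U - LT \<sigma> ` G" using t by (auto simp: in_keys_iff)
qed

lemma NF_id:
  assumes "Poly_Mapping.keys f \<inter> LT \<sigma> ` G = {}"
  shows "NF G f = f"
proof -
  have "(\<Sum>g\<in>G. scale_poly (Poly_Mapping.lookup f (LT \<sigma> g)) g) = 0"
    using assms by (intro sum.neutral) (auto simp: in_keys_iff)
  then show ?thesis by (simp add: NF_def)
qed

end

section \<open>The Marked Interreduction\<close>

definition row_poly :: "'x pterm list \<Rightarrow> (nat \<Rightarrow> nat \<Rightarrow> 'k::field) \<Rightarrow> nat \<Rightarrow> ('x, 'k) mpoly" where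
  "row_poly ts A i = (\<Sum>j<length ts. monomial (A i j) (ts ! j))"

lemma lookup_row_poly:
  assumes "distinct ts" and "j < length ts"
  shows "Poly_Mapping.lookup (row_poly ts A i) (ts ! j) = A i j"
  using assms by (simp add: row_poly_def lookup_sum lookup_monomial nth_eq_iff_index_eq)

lemma keys_row_poly_subset: "Poly_Mapping.keys (row_poly ts A i) \<subseteq> set ts"
  unfolding row_poly_def
  by (rule order_trans[OF keys_sum_subset]) (auto simp: keys_monomial split: if_splits)

lemma row_poly_linear:
  assumes "\<And>j. j < length ts \<Longrightarrow> A' k j = a * A k j + b * B i j"
  shows "row_poly ts A' k = scale_poly a (row_poly ts A k) + scale_poly b (row_poly ts B i)"
  unfolding row_poly_def poly_vs.scale_sum_right scale_monomial sum.distrib[symmetric] monomial_add[symmetric]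
  using assms by (intro sum.cong) auto

text \<open>The invariant before round \<open>i\<close>: every pivot is the leading position of its row, unless that
  row is zero, and for nonzero rows among the first \<open>i\<close> the pivot column is a unit vector. A zero row
  still has some pivot below \<open>l\<close>; then the entry there is zero and the row is recognized as zero by
  the algorithm.\<close>

definition pivots_ok :: "nat \<Rightarrow> nat \<Rightarrow> nat \<Rightarrow> (nat \<Rightarrow> nat \<Rightarrow> 'k::field) \<Rightarrow> (nat \<Rightarrow> nat) \<Rightarrow> bool" where
  "pivots_ok s l i A p \<longleftrightarrow>
     (\<forall>k<s. p k < l \<and> (\<forall>j<l. A k j \<noteq> 0 \<longrightarrow> A k (p k) \<noteq> 0 \<and> p k \<le> j)) \<and>
     (\<forall>k<s. k < i \<longrightarrow> A k (p k) \<noteq> 0 \<longrightarrow> A k (p k) = 1 \<and> (\<forall>m<s. m \<noteq> k \<longrightarrow> A m (p k) = 0))"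

text \<open>Subtracting row \<open>i\<close> moves the leading position of a later row only if both rows have the same
  pivot, and exactly in this case a new pivot is chosen. It does not move the leading position of
  an earlier row, since row \<open>i\<close> has a zero in the pivot column of that row.\<close>

lemma pivots_ok_mi_round:
  fixes A :: "nat \<Rightarrow> nat \<Rightarrow> 'k::field"
  assumes inv: "pivots_ok s l i A p" and i: "i < s" and rnd: "mi_round s l i (A, p) = (A', p')"
  shows "pivots_ok s l (Suc i) A' p'"
    and "\<exists>c d. c \<noteq> 0 \<and> d i = 0 \<and>
           (\<forall>k<s. \<forall>j. A' k j = (if k = i then c else 1) * A k j + d k * A i j)"
proof -
  have lt: "p k < l" if "k < s" for k
    using inv that by (auto simp: pivots_ok_def)
  have nz: "A k (p k) \<noteq> 0" and le: "p k \<le> j" if "k < s" "j < l" "A k j \<noteq> 0" for k j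
    using inv that by (auto simp: pivots_ok_def)
  have one: "A k (p k) = 1" if "k < i" "A k (p k) \<noteq> 0" for k
    using inv that i by (auto simp: pivots_ok_def)
  have clear: "A m (p k) = 0" if "k < i" "A k (p k) \<noteq> 0" "m < s" "m \<noteq> k" for k m
    using inv that i by (auto simp: pivots_ok_def)
  \<comment> \<open>If the pivot entry is zero, then so is row \<open>i\<close>, and the round changes nothing.\<close>
  define c where "c = (if A i (p i) = 0 then 1 else inverse (A i (p i)))"
  define d where "d k = (if k = i then 0 else - A k (p i) * c)" for k
  have c0: "c \<noteq> 0" by (simp add: c_def)
  have norm: "mi_normalize i A p = A(i := (\<lambda>j. c * A i j))"
    by (auto simp: mi_normalize_def c_def fun_eq_iff)
  have A': "A' = mi_eliminate s i (mi_normalize i A p) p"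
    and p': "p' = mi_new_pivots s l i A' p"
    using rnd by (auto simp: mi_round_def Let_def)
  have A'_eq: "A' k j = (if k = i then c else 1) * A k j + d k * A i j" if "k < s" for k j
    using that by (auto simp: A' mi_eliminate_def norm d_def)
  then show "\<exists>c d. c \<noteq> 0 \<and> d i = 0 \<and>
           (\<forall>k<s. \<forall>j. A' k j = (if k = i then c else 1) * A k j + d k * A i j)"
    using c0 by (intro exI[of _ c] exI[of _ d]) (auto simp: d_def)
  have row_i: "A' i j = c * A i j" for j
    using A'_eq[OF i] by (simp add: d_def)
  have other: "A' k j = A k j - A k (p i) * c * A i j" if "k < s" "k \<noteq> i" for k j
    using A'_eq[OF that(1), of j] that by (simp add: d_def)
  have col_i: "A' k (p i) = 0" if "k < s" "k \<noteq> i" "A i (p i) \<noteq> 0" for k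
    using other[OF that(1,2), of "p i"] that(3) by (simp add: c_def)
  have zero_row: "A' k j = 0" if "k < s" "k \<noteq> i" "A k (p k) = 0" "j < l" for k j
    using other[OF that(1,2), of j] nz[OF that(1)] lt[OF i] that(3,4) by (metis diff_0_right mult_zero_left)
  have keep: "A' k (p k) = A k (p k) \<and> (\<forall>j<p k. A' k j = 0)"
    if k: "k < s" "k \<noteq> i" "p k \<noteq> p i \<or> A i (p i) = 0" "A k (p k) \<noteq> 0" for k
  proof -
    have "A k (p i) * A i j = 0" if j: "j \<le> p k" for j
    proof (rule ccontr)
      assume *: "A k (p i) * A i j \<noteq> 0"
      have "j < l" using j lt[OF k(1)] by simp
      then have "p k \<le> p i" "p i \<le> j" "A i (p i) \<noteq> 0"
        using le[OF k(1) lt[OF i]] le[OF i] nz[OF i] * by auto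
      with j k(3) show False by simp
    qed
    moreover have "A k j = 0" if "j < p k" for j
      using le[OF k(1), of j] lt[OF k(1)] that by auto
    ultimately show ?thesis
      using other[OF k(1,2)] by (auto simp: mult.assoc mult.left_commute[of c])
  qed
  have early: "p k \<noteq> p i \<or> A i (p i) = 0" if "k < i" "A k (p k) \<noteq> 0" for k
    using clear[OF that i] that by auto
  have p'_le: "p' k = p k" if "k \<le> i" for k
    using that by (simp add: p' mi_new_pivots_def)
  have lead: "p' k < l \<and> (\<forall>j<l. A' k j \<noteq> 0 \<longrightarrow> A' k (p' k) \<noteq> 0 \<and> p' k \<le> j)" if k: "k < s" for k
  proof (cases "i < k \<and> A' k (p k) = 0 \<and> (\<exists>j<l. A' k j \<noteq> 0)")
    case True
    then obtain j where j: "j < l \<and> A' k j \<noteq> 0" by auto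
    have eq: "p' k = (LEAST j. j < l \<and> A' k j \<noteq> 0)"
      using True k by (simp add: p' mi_new_pivots_def)
    show ?thesis
      unfolding eq using LeastI[of "\<lambda>j. j < l \<and> A' k j \<noteq> 0", OF j]
        Least_le[of "\<lambda>j. j < l \<and> A' k j \<noteq> 0"] by blast
  next
    case False
    then have eq: "p' k = p k" by (auto simp: p' mi_new_pivots_def)
    show ?thesis
      unfolding eq
    proof (intro conjI allI impI)
      show "p k < l" by (rule lt[OF k])
      fix j assume j: "j < l" "A' k j \<noteq> 0"
      have "A' k (p k) \<noteq> 0 \<and> p k \<le> j"
      proof (cases "k = i")
        case True
        then show ?thesis using j nz[OF i] le[OF i] c0 by (auto simp: row_i)
      next
        case ki: False
        have nzk: "A k (p k) \<noteq> 0"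
          using zero_row[OF k ki] j by blast
        have "p k \<noteq> p i \<or> A i (p i) = 0"
        proof (cases "k < i")
          case True
          then show ?thesis using early nzk by blast
        next
          case False
          then have "A' k (p k) \<noteq> 0"
            using \<open>\<not> (i < k \<and> A' k (p k) = 0 \<and> (\<exists>j<l. A' k j \<noteq> 0))\<close> ki j by auto
          then show ?thesis using col_i[OF k ki] by metis
        qed
        with keep[OF k ki _ nzk] nzk j show ?thesis by (metis not_le)
      qed
      then show "A' k (p k) \<noteq> 0" "p k \<le> j" by auto
    qed
  qed
  have cleared: "A' k (p' k) = 1 \<and> (\<forall>m<s. m \<noteq> k \<longrightarrow> A' m (p' k) = 0)"
    if k: "k < Suc i" "A' k (p' k) \<noteq> 0" for k
  proof (cases "k = i")
    case True
    then have "A i (p i) \<noteq> 0" using k p'_le by (auto simp: row_i)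
    then show ?thesis using True p'_le col_i by (auto simp: row_i c_def)
  next
    case False
    with k i have ki: "k < i" "k < s" by auto
    have nzk: "A k (p k) \<noteq> 0"
      using zero_row[OF ki(2) False _ lt[OF ki(2)]] k(2) p'_le[of k] ki by auto
    have "A i (p k) = 0" using clear[OF ki(1) nzk i] ki by auto
    then have "A' m (p k) = (if m = i then 0 else A m (p k))" if "m < s" for m
      using other[OF that] row_i by auto
    then show ?thesis using p'_le[of k] ki one[OF ki(1) nzk] clear[OF ki(1) nzk] False by auto
  qed
  show "pivots_ok s l (Suc i) A' p'"
    unfolding pivots_ok_def using lead cleared by auto
qed

text \<open>A round performs invertible row operations.\<close>

lemma span_rows_mi_round:
  assumes c: "c \<noteq> 0" and d: "d i = 0" and i: "i < s"
    and A': "\<And>k j. k < s \<Longrightarrow> A' k j = (if k = i then c else 1) * A k j + d k * A i j"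
  shows "K_span (row_poly ts A' ` {..<s}) = K_span (row_poly ts A ` {..<s})"
proof -
  let ?r = "row_poly ts A" and ?r' = "row_poly ts A'"
  have r': "?r' k = scale_poly (if k = i then c else 1) (?r k) + scale_poly (d k) (?r i)" if "k < s" for k
    by (rule row_poly_linear) (rule A'[OF that])
  have ri: "?r i = scale_poly (inverse c) (?r' i)"
    using r'[OF i] c d by simp
  have "?r' k \<in> K_span (?r ` {..<s})" if "k < s" for k
    unfolding r'[OF that] using that i
    by (intro poly_vs.span_add poly_vs.span_scale poly_vs.span_base) auto
  moreover have "?r k \<in> K_span (?r' ` {..<s})" if k: "k < s" for k
  proof (cases "k = i")
    case True
    then show ?thesis using ri i by (metis imageI lessThan_iff poly_vs.span_base poly_vs.span_scale)
  next
    case False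
    then have "?r k = ?r' k - scale_poly (d k) (scale_poly (inverse c) (?r' i))"
      using r'[OF k] ri by simp
    then show ?thesis using k i
      by (auto intro!: poly_vs.span_diff poly_vs.span_scale intro: poly_vs.span_base)
  qed
  ultimately show ?thesis
    by (subst poly_vs.span_eq) auto
qed

context degree_ordering
begin

theorem marked_interreduction_reduced:
  fixes hs :: "('x, 'k::field) marked list"
  assumes hs: "\<And>m. m \<in> set hs \<Longrightarrow> fst m \<noteq> 0 \<and> snd m = LT \<sigma> (fst m)"
    and ts: "term_enumeration hs ts" and sorted: "sorted_wrt (term_gt \<sigma>) ts"
  obtains H where "marked_interreduction hs ts = mark ` H" and "reduced H"
    and "K_span H = K_span (fst ` set hs)"
proof -
  let ?s = "length hs" and ?l = "length ts"
  have dist: "distinct ts" and set_ts: "set ts = supp_set (fst ` set hs)"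
    using ts by (auto simp: term_enumeration_def)
  have le_iff: "(ts ! j, ts ! k) \<in> \<sigma> \<longleftrightarrow> k \<le> j" if jk: "j < ?l" "k < ?l" for j k
  proof -
    have gt: "(ts ! b, ts ! a) \<in> \<sigma> \<and> ts ! a \<noteq> ts ! b" if "a < b" "b < ?l" for a b
      using sorted_wrt_nth_less[OF sorted that] by (auto simp: term_gt_def)
    consider "k < j" | "j = k" | "j < k" by linarith
    then show ?thesis
      by cases (use gt[of k j] gt[of j k] jk le_antisym in auto)
  qed
  define A0 p0 where "A0 = fst (mi_init hs ts)" and "p0 = snd (mi_init hs ts)"
  have row0: "row_poly ts A0 i = fst (hs ! i)" if i: "i < ?s" for i
  proof (rule poly_mapping_eqI)
    fix t
    show "Poly_Mapping.lookup (row_poly ts A0 i) t = Poly_Mapping.lookup (fst (hs ! i)) t"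
    proof (cases "t \<in> set ts")
      case True
      then obtain j where "j < ?l" "t = ts ! j" by (metis in_set_conv_nth)
      then show ?thesis by (simp add: lookup_row_poly[OF dist] A0_def mi_init_def)
    next
      case False
      then have "t \<notin> Poly_Mapping.keys (row_poly ts A0 i)" "t \<notin> Poly_Mapping.keys (fst (hs ! i))"
        using i keys_row_poly_subset[of ts A0 i] set_ts by (blast, auto simp: supp_set_def)
      then show ?thesis by (simp add: in_keys_iff)
    qed
  qed
  have pivots0: "pivots_ok ?s ?l 0 A0 p0"
    unfolding pivots_ok_def
  proof (intro conjI allI impI)
    fix k assume k: "k < ?s"
    let ?f = "fst (hs ! k)"
    have f: "?f \<noteq> 0" "snd (hs ! k) = LT \<sigma> ?f" using hs[of "hs ! k"] k by auto
    then have "LT \<sigma> ?f \<in> set ts" using LT_in_keys[OF f(1)] k unfolding set_ts supp_set_def by auto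
    then obtain q where q: "q < ?l" "ts ! q = LT \<sigma> ?f" by (metis in_set_conv_nth)
    have "(THE j. j < ?l \<and> ts ! j = snd (hs ! k)) = q"
      using q f nth_eq_iff_index_eq[OF dist _ q(1)] by (intro the_equality) metis+
    then have p0: "p0 k = q" by (simp add: p0_def mi_init_def)
    show "p0 k < ?l" using p0 q by simp
    fix j assume j: "j < ?l" "A0 k j \<noteq> 0"
    have A0: "A0 k j = Poly_Mapping.lookup ?f (ts ! j)" for j by (simp add: A0_def mi_init_def)
    show "A0 k (p0 k) \<noteq> 0" using LT_in_keys[OF f(1)] by (simp add: A0 p0 q in_keys_iff)
    have "(ts ! j, ts ! q) \<in> \<sigma>" using LT_max[of "ts ! j" ?f] j q by (simp add: A0 in_keys_iff)
    then show "p0 k \<le> j" using le_iff[OF j(1) q(1)] p0 by simp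
  qed simp_all
  have rounds: "n \<le> ?s \<Longrightarrow>
      (case fold (mi_round ?s ?l) [0..<n] (A0, p0) of (A, p) \<Rightarrow>
        pivots_ok ?s ?l n A p \<and> K_span (row_poly ts A ` {..<?s}) = K_span (row_poly ts A0 ` {..<?s}))" for n
  proof (induction n)
    case 0
    then show ?case using pivots0 by simp
  next
    case (Suc n)
    obtain A p where Ap: "fold (mi_round ?s ?l) [0..<n] (A0, p0) = (A, p)" by fastforce
    obtain A' p' where Ap': "mi_round ?s ?l n (A, p) = (A', p')" by fastforce
    have IH: "pivots_ok ?s ?l n A p" "K_span (row_poly ts A ` {..<?s}) = K_span (row_poly ts A0 ` {..<?s})"
      using Suc Ap by auto
    have n: "n < ?s" using Suc.prems by simp
    note step = pivots_ok_mi_round[OF IH(1) n Ap']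
    have "K_span (row_poly ts A' ` {..<?s}) = K_span (row_poly ts A ` {..<?s})"
      using step(2) span_rows_mi_round[OF _ _ n] by blast
    then show ?case using Ap Ap' step(1) IH(2) by simp
  qed
  obtain A p where Ap: "mi_final hs ts = (A, p)" by fastforce
  have fold_eq: "fold (mi_round ?s ?l) [0..<?s] (A0, p0) = (A, p)"
    using Ap by (simp add: mi_final_def A0_def p0_def)
  have piv: "pivots_ok ?s ?l ?s A p"
    and span: "K_span (row_poly ts A ` {..<?s}) = K_span (row_poly ts A0 ` {..<?s})"
    using rounds[of ?s] fold_eq by auto
  let ?r = "row_poly ts A"
  define H where "H = {?r i | i. i < ?s \<and> ?r i \<noteq> 0}"
  have look: "Poly_Mapping.lookup (?r i) (ts ! j) = A i j" if "j < ?l" for i j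
    by (rule lookup_row_poly[OF dist that])
  have lt: "p i < ?l" if "i < ?s" for i using piv that by (auto simp: pivots_ok_def)
  have LT: "A i (p i) \<noteq> 0" "LT \<sigma> (?r i) = ts ! p i" if i: "i < ?s" "?r i \<noteq> 0" for i
  proof -
    have col: "A i (p i) \<noteq> 0 \<and> (t, ts ! p i) \<in> \<sigma>" if t: "t \<in> Poly_Mapping.keys (?r i)" for t
    proof -
      have "t \<in> set ts" using t keys_row_poly_subset by blast
      then obtain j where j: "j < ?l" "t = ts ! j" by (metis in_set_conv_nth)
      then have "A i j \<noteq> 0" using t look by (simp add: in_keys_iff)
      then show ?thesis using piv i j le_iff[OF j(1) lt[OF i(1)]] by (auto simp: pivots_ok_def)
    qed
    then show "A i (p i) \<noteq> 0" using LT_in_keys[OF i(2)] by blast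
    then have "ts ! p i \<in> Poly_Mapping.keys (?r i)" using look[OF lt[OF i(1)]] by (simp add: in_keys_iff)
    then show "LT \<sigma> (?r i) = ts ! p i" using col by (intro LT_eqI) auto
  qed
  have "marked_interreduction hs ts = {(?r i, ts ! p i) | i. i < ?s \<and> ?r i \<noteq> 0}"
    by (simp add: marked_interreduction_def Ap row_poly_def)
  also have "\<dots> = mark ` H"
    unfolding H_def mark_def using LT(2) by (auto simp: image_iff)
  finally have 1: "marked_interreduction hs ts = mark ` H" .
  have 2: "reduced H"
    unfolding reduced_def
  proof (intro conjI ballI impI)
    show "finite H" by (simp add: H_def)
  next
    fix h assume "h \<in> H"
    then obtain i where i: "i < ?s" "h = ?r i" "?r i \<noteq> 0" by (auto simp: H_def)
    then show "h \<noteq> 0" by simp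
    have "A i (p i) = 1" using piv i(1) LT(1)[OF i(1,3)] by (auto simp: pivots_ok_def)
    then show "Poly_Mapping.lookup h (LT \<sigma> h) = 1"
      using LT(2)[OF i(1,3)] look[OF lt[OF i(1)]] i(2) by simp
  next
    fix f h assume "f \<in> H" "h \<in> H" "f \<noteq> h"
    then obtain i k where i: "i < ?s" "f = ?r i" "?r i \<noteq> 0" and k: "k < ?s" "h = ?r k" "i \<noteq> k"
      by (auto simp: H_def)
    have "A k (p i) = 0" using piv i(1) k LT(1)[OF i(1,3)] by (auto simp: pivots_ok_def)
    then show "LT \<sigma> f \<notin> Poly_Mapping.keys h"
      using LT(2)[OF i(1,3)] look[OF lt[OF i(1)]] i(2) k(2) by (simp add: in_keys_iff)
  qed
  have "fst ` set hs = row_poly ts A0 ` {..<?s}"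
    using row0 by (auto simp: set_conv_nth)
  moreover have "K_span H = K_span (?r ` {..<?s})"
    by (subst poly_vs.span_eq) (auto simp: H_def intro: poly_vs.span_base,
        metis (mono_tags, lifting) mem_Collect_eq poly_vs.span_base poly_vs.span_zero)
  ultimately have 3: "K_span H = K_span (fst ` set hs)"
    using span by simp
  from 1 2 3 show thesis by (rule that)
qed

end

section \<open>Commuting actions\<close>

lemma funpow_swap:
  assumes "\<And>z. f (g z) = g (f z)"
  shows "(f ^^ m) ((g ^^ n) z) = (g ^^ n) ((f ^^ m) z)"
proof -
  have *: "(f ^^ m) (g z) = g ((f ^^ m) z)" for z
    by (induction m) (simp_all add: assms)
  show ?thesis by (induction n) (simp_all add: *)
qed

text \<open>Commuting operators \<open>X\<^sub>i\<close> define an action of the monoid of terms, the term \<open>t\<close> acting as the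
  product of the powers \<open>X\<^sub>i\<close> to the exponents of \<open>t\<close>. Here the operators commute only on a subset \<open>M\<close>.
  Replacing them by the identity outside of \<open>M\<close> makes them commute everywhere, so that the product
  can be formed as a fold over the indeterminates in an arbitrary order.\<close>

lemma commuting_action:
  fixes X :: "'x::finite \<Rightarrow> 'a \<Rightarrow> 'a"
  assumes closed: "\<And>i z. z \<in> M \<Longrightarrow> X i z \<in> M" and e: "e \<in> M"
    and comm: "\<And>i j z. z \<in> M \<Longrightarrow> X i (X j z) = X j (X i z)"
  obtains \<phi> :: "'x pterm \<Rightarrow> 'a"
  where "\<phi> 0 = e" and "\<And>i t. \<phi> (var_term i + t) = X i (\<phi> t)" and "\<And>t. \<phi> t \<in> M"
proof -
  define Y where "Y i z = (if z \<in> M then X i z else z)" for i z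
  have Y_comm: "Y i (Y j z) = Y j (Y i z)" for i j z
    by (simp add: Y_def closed comm)
  define g where "g t i = Y i ^^ Poly_Mapping.lookup t i" for t :: "'x pterm" and i
  have g: "comp_fun_commute_on UNIV (g t)" for t
    by unfold_locales (simp add: g_def fun_eq_iff funpow_swap Y_comm)
  define \<phi> where "\<phi> t = Finite_Set.fold (g t) e UNIV" for t
  have "Finite_Set.fold (g 0) e A = e" if "finite A" for A
    using that
  proof (induction A)
    case (insert i A)
    have "Finite_Set.fold (g 0) e (insert i A) = g 0 i (Finite_Set.fold (g 0) e A)"
      using insert.hyps by (intro comp_fun_commute_on.fold_insert[OF g]) auto
    also have "\<dots> = e" unfolding insert.IH by (simp add: g_def)
    finally show ?case .
  qed simp
  then have 0: "\<phi> 0 = e" by (simp add: \<phi>_def)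
  have Y: "\<phi> (var_term i + t) = Y i (\<phi> t)" for i t
  proof -
    have look: "Poly_Mapping.lookup (var_term i + t) j
        = (if j = i then Suc (Poly_Mapping.lookup t j) else Poly_Mapping.lookup t j)" for j
      by (auto simp: lookup_add var_term_def lookup_single when_def)
    have rec: "\<phi> u = g u i (Finite_Set.fold (g u) e (UNIV - {i}))" for u
      unfolding \<phi>_def by (rule comp_fun_commute_on.fold_rec[OF g]) simp_all
    have "Finite_Set.fold (g (var_term i + t)) e (UNIV - {i}) = Finite_Set.fold (g t) e (UNIV - {i})"
      by (intro Finite_Set.fold_cong[OF g g]) (auto simp: g_def look)
    then show ?thesis
      unfolding rec[of t] rec[of "var_term i + t"] by (simp add: g_def look)
  qed
  have M: "\<phi> t \<in> M" for t
    by (induction t rule: term_induct) (simp_all add: 0 e Y, simp add: Y_def closed)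
  show thesis
    using 0 Y M by (intro that[of \<phi>]) (simp_all add: Y_def)
qed

section \<open>Stable reduced sets\<close>

text \<open>Multiplication by an arbitrary polynomial is composed of multiplications by indeterminates,
  scalings and sums. Steps with a single indeterminate are what reduced sets and prolongations
  can handle.\<close>

lemma ideal_generated_induct [consumes 1, case_names zero base add scale var]:
  fixes f :: "('x::finite, 'k::field) mpoly"
  assumes "f \<in> ideal_generated G" and zero: "P 0" and base: "\<And>g. g \<in> G \<Longrightarrow> P g"
    and add: "\<And>f g. P f \<Longrightarrow> P g \<Longrightarrow> P (f + g)" and scale: "\<And>c f. P f \<Longrightarrow> P (scale_poly c f)"
    and var: "\<And>i f. P f \<Longrightarrow> P (var_poly i * f)"
  shows "P f"
  using assms(1)
proof (induction rule: ideal.span_induct_alt)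
  case base
  show ?case by (rule zero)
next
  case (step h x y)
  have mono: "P (monomial 1 t * x)" for t
  proof (induction t rule: term_induct)
    case zero
    then show ?case using base[OF step(1)] by (simp add: monomial_def)
  next
    case (var i t)
    have "monomial 1 (var_term i + t) * x = var_poly i * (monomial 1 t * x)"
      by (simp add: var_poly_def monomial_mult mult.assoc[symmetric])
    then show ?case using assms(6)[OF var] by simp
  qed
  have "monomial c t * x = scale_poly c (monomial 1 t * x)" for c t
    unfolding scale_poly_def mult.assoc[symmetric] monomial_mult by simp
  then have mono': "P (monomial c t * x)" for c t using scale[OF mono] by metis
  have sum: "P (\<Sum>t\<in>A. monomial (Poly_Mapping.lookup h t) t * x)" if "finite A" for A
    using that
  proof (induction A)
    case (insert t A)
    then show ?case unfolding sum.insert[OF insert.hyps] by (intro add mono')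
  qed (use zero in simp)
  have "h * x = (\<Sum>t\<in>Poly_Mapping.keys h. monomial (Poly_Mapping.lookup h t) t * x)"
    unfolding sum_distrib_right[symmetric] poly_eq_sum_monomials[symmetric] ..
  then have "P (h * x)" using sum[of "Poly_Mapping.keys h"] by simp
  then show ?case using step(2) by (rule add)
qed

context degree_ordering
begin

text \<open>No leading term in \<open>U\<close> is missed when \<open>G\<close> is multiplied by the indeterminates. This is what
  the loop of the algorithm has achieved when it does not find any new polynomial.\<close>

definition stable :: "'x pterm set \<Rightarrow> ('x, 'k::field) mpoly set \<Rightarrow> bool" where
  "stable U G \<longleftrightarrow> (\<forall>f\<in>K_span (polys_plus G). f \<noteq> 0 \<longrightarrow> LT \<sigma> f \<in> U \<longrightarrow> LT \<sigma> f \<in> LT \<sigma> ` G)"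

text \<open>The normal form of \<open>f\<close> lies in the span of the prolongation and has its support in \<open>U\<close> but
  contains no leading term of \<open>G\<close>, which stability permits only for 0.\<close>

lemma stable_span:
  assumes G: "reduced G" "supp_set G \<subseteq> U" and st: "stable U G"
    and f: "f \<in> K_span (polys_plus G)" "Poly_Mapping.keys f \<subseteq> U"
  shows "f \<in> K_span G"
proof -
  have "f - NF G f \<in> K_span (polys_plus G)"
    using diff_NF_in_span poly_vs.span_mono[OF polys_plus_superset] by blast
  then have "NF G f \<in> K_span (polys_plus G)"
    using poly_vs.span_diff[OF f(1)] by fastforce
  moreover have "Poly_Mapping.keys (NF G f) \<subseteq> U - LT \<sigma> ` G"
    by (rule keys_NF[OF G(1) f(2) G(2)])
  ultimately have "NF G f = 0"
    using st LT_in_keys unfolding stable_def by blast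
  then show ?thesis using NF_eq_0_iff[OF G(1)] by simp
qed

text \<open>If \<open>s\<close> is the leading term of some \<open>g\<close> in \<open>G\<close> and \<open>x\<^sub>i s\<close> is in \<open>U\<close>, then stability, applied to
  \<open>x\<^sub>i g\<close>, makes \<open>x\<^sub>i s\<close> a leading term of \<open>G\<close>. So all multiples of \<open>s\<close> in \<open>U\<close> are leading terms.\<close>

lemma stable_order_ideal:
  assumes U: "order_ideal U" and G: "0 \<notin> G" and st: "stable U G"
  shows "order_ideal (U - LT \<sigma> ` G)"
proof -
  have up: "s + u \<in> U \<longrightarrow> s + u \<in> LT \<sigma> ` G" if s: "s \<in> LT \<sigma> ` G" for s u
  proof (induction u rule: term_induct)
    case zero
    then show ?case using s by simp
  next
    case (var i u)
    show ?case
    proof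
      assume su: "s + (var_term i + u) \<in> U"
      have eq: "s + (var_term i + u) = var_term i + (s + u)" by (simp add: ac_simps)
      then have "s + u \<in> U" using U su unfolding order_ideal_def by (metis term_dvd_add_left(1))
      then obtain g where g: "g \<in> G" "LT \<sigma> g = s + u" using var by auto
      then have "LT \<sigma> (var_poly i * g) = s + (var_term i + u)" "var_poly i * g \<noteq> 0"
        using G LT_var_times[of g i] eq var_times_eq_0_iff[of i g] by auto
      moreover have "var_poly i * g \<in> K_span (polys_plus G)"
        by (intro poly_vs.span_base polys_plus_var g(1))
      ultimately show "s + (var_term i + u) \<in> LT \<sigma> ` G"
        using st su unfolding stable_def by metis
    qed
  qed
  show ?thesis
    using U up unfolding order_ideal_def by (fastforce simp: term_dvd_def)
qed

lemma NF_sum: "NF G (\<Sum>a\<in>A. f a) = (\<Sum>a\<in>A. NF G (f a))"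
  by (induction A rule: infinite_finite_induct) (simp_all add: NF_add)

text \<open>The span of \<open>S = U - LT \<sigma> ` G\<close> becomes a module over the polynomial ring by means of the
  operators \<open>X\<^sub>i f = NF G (x\<^sub>i f)\<close>. They map it to itself since the border of \<open>S\<close> is in \<open>U\<close>, and they
  commute since \<open>X\<^sub>i X\<^sub>j f\<close> and \<open>X\<^sub>j X\<^sub>i f\<close> are normal forms of polynomials supported in \<open>U\<close> that differ
  by an element of the span of the prolongation. The map \<open>\<Phi>\<close>, which lets a polynomial act on the
  normal form of 1, agrees with \<open>NF G\<close> on polynomials supported in \<open>U\<close>. Therefore it vanishes on
  \<open>G\<close>, hence on the ideal, while it fixes all polynomials supported in \<open>S\<close>.\<close>

theorem stable_ideal_normal_form:
  fixes G :: "('x, 'k::field) mpoly set"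
  assumes G: "reduced G" "supp_set G \<subseteq> U" and st: "stable U G" and U: "order_ideal U" "U \<noteq> {}"
    and bd: "border (U - LT \<sigma> ` G) \<subseteq> U"
    and f: "f \<in> ideal_generated G" "Poly_Mapping.keys f \<subseteq> U - LT \<sigma> ` G"
  shows "f = 0"
proof -
  define S where "S = U - LT \<sigma> ` G"
  define M where "M = {f :: ('x, 'k) mpoly. Poly_Mapping.keys f \<subseteq> S}"
  define X where "X i f = NF G (var_poly i * f)" for i and f :: "('x, 'k) mpoly"
  have var_U: "Poly_Mapping.keys (var_poly i * f) \<subseteq> U" if "f \<in> M" for i f
  proof -
    have "var_term i + t \<in> U" if "t \<in> S" for t
    proof (cases "var_term i + t \<in> S")
      case False
      then have "var_term i + t \<in> border S" using that by (auto simp: border_def)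
      then show ?thesis using bd by (auto simp: S_def)
    qed (simp add: S_def)
    then show ?thesis using that by (auto simp: keys_var_times M_def)
  qed
  have NF_M: "NF G f \<in> M" if "Poly_Mapping.keys f \<subseteq> U" for f
    using keys_NF[OF G(1) that G(2)] by (simp add: M_def S_def)
  \<comment> \<open>All equalities below come from stability by this rule.\<close>
  have NF_eqI: "NF G f = NF G g"
    if "f - g \<in> K_span (polys_plus G)" "Poly_Mapping.keys f \<subseteq> U" "Poly_Mapping.keys g \<subseteq> U" for f g
  proof -
    have "f - g \<in> K_span G"
      using that keys_minus_subset[of f g] by (intro stable_span[OF G st]) auto
    then show ?thesis using NF_eq_0_iff[OF G(1), of "f - g"] by (simp add: NF_diff)
  qed
  have X_M: "X i z \<in> M" if "z \<in> M" for i z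
    unfolding X_def by (intro NF_M var_U that)
  have comm: "X i (X j z) = X j (X i z)" if z: "z \<in> M" for i j z
  proof -
    let ?a = "var_poly i * NF G (var_poly j * z)" and ?b = "var_poly j * NF G (var_poly i * z)"
    have "?a - ?b = var_poly j * (var_poly i * z - NF G (var_poly i * z))
        - var_poly i * (var_poly j * z - NF G (var_poly j * z))"
      unfolding right_diff_distrib mult.left_commute[of "var_poly j" "var_poly i" z] by simp
    also have "\<dots> \<in> K_span (polys_plus G)"
      by (intro poly_vs.span_diff var_times_K_span diff_NF_in_span)
    finally show ?thesis
      using var_U[OF X_M[OF z]] unfolding X_def by (intro NF_eqI) auto
  qed
  have zero_U: "0 \<in> U" using U unfolding order_ideal_def by (metis ex_in_conv term_dvd_zero)
  have e_M: "NF G (monomial 1 0) \<in> M"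
    using zero_U by (intro NF_M) (simp add: keys_monomial)
  obtain \<phi> where \<phi>0: "\<phi> 0 = NF G (monomial 1 0)"
    and \<phi>_var: "\<And>i t. \<phi> (var_term i + t) = X i (\<phi> t)" and \<phi>_M: "\<And>t. \<phi> t \<in> M"
    using commuting_action[of M X, OF X_M e_M comm] by blast
  have \<phi>_U: "t \<in> U \<longrightarrow> \<phi> t = NF G (monomial 1 t)" for t
  proof (induction t rule: term_induct)
    case zero
    show ?case by (simp add: \<phi>0)
  next
    case (var i t)
    show ?case
    proof
      assume it: "var_term i + t \<in> U"
      then have t: "t \<in> U" using U(1) unfolding order_ideal_def by (metis term_dvd_add_left(1))
      have "monomial 1 (var_term i + t) = var_poly i * (monomial 1 t :: ('x, 'k) mpoly)"
        by (simp add: var_poly_def monomial_mult)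
      then have "monomial 1 (var_term i + t) - var_poly i * NF G (monomial 1 t)
          = var_poly i * (monomial 1 t - NF G (monomial 1 t))"
        by (simp add: right_diff_distrib)
      also have "\<dots> \<in> K_span (polys_plus G)"
        by (intro var_times_K_span diff_NF_in_span)
      finally have "NF G (monomial 1 (var_term i + t)) = NF G (var_poly i * NF G (monomial 1 t))"
        using it t by (intro NF_eqI var_U NF_M) (simp_all add: keys_monomial)
      then show "\<phi> (var_term i + t) = NF G (monomial 1 (var_term i + t))"
        using var t by (simp add: \<phi>_var X_def)
    qed
  qed
  define \<Phi> where "\<Phi> f = (\<Sum>t\<in>Poly_Mapping.keys f. scale_poly (Poly_Mapping.lookup f t) (\<phi> t))"
    for f :: "('x, 'k) mpoly"
  have \<Phi>_superset: "\<Phi> f = (\<Sum>t\<in>A. scale_poly (Poly_Mapping.lookup f t) (\<phi> t))"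
    if "finite A" "Poly_Mapping.keys f \<subseteq> A" for f A
    unfolding \<Phi>_def using that by (intro sum.mono_neutral_left) (auto simp: in_keys_iff)
  have \<Phi>_U: "\<Phi> f = NF G f" if f: "Poly_Mapping.keys f \<subseteq> U" for f
  proof -
    have "NF G f = (\<Sum>t\<in>Poly_Mapping.keys f. NF G (scale_poly (Poly_Mapping.lookup f t) (monomial 1 t)))"
      by (subst poly_eq_sum_monomials[of f]) (simp add: NF_sum scale_monomial)
    also have "\<dots> = \<Phi> f"
      unfolding \<Phi>_def NF_scale using f \<phi>_U by (intro sum.cong) auto
    finally show ?thesis ..
  qed
  have \<Phi>_ideal: "\<Phi> f = 0" if "f \<in> ideal_generated G" for f
    using that
  proof (induction rule: ideal_generated_induct)
    case zero
    show ?case by (simp add: \<Phi>_def)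
  next
    case (base g)
    have "Poly_Mapping.keys g \<subseteq> U" using base G(2) by (auto simp: supp_set_def)
    then show ?case using \<Phi>_U NF_eq_0_iff[OF G(1)] poly_vs.span_base[OF base] by simp
  next
    case (add f g)
    let ?A = "Poly_Mapping.keys f \<union> Poly_Mapping.keys g"
    have "\<Phi> (f + g) = \<Phi> f + \<Phi> g"
      using keys_add[of f g]
      by (simp add: \<Phi>_superset[of ?A] lookup_add poly_vs.scale_left_distrib sum.distrib)
    then show ?case using add by simp
  next
    case (scale c f)
    have "\<Phi> (scale_poly c f) = scale_poly c (\<Phi> f)"
      using keys_scale_subset[of c f]
      by (simp add: \<Phi>_superset[of "Poly_Mapping.keys f"] lookup_scale poly_vs.scale_sum_right)
    then show ?case using scale by simp
  next
    case (var i f)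
    have "\<Phi> (var_poly i * f)
        = (\<Sum>t\<in>Poly_Mapping.keys f. scale_poly (Poly_Mapping.lookup f t) (X i (\<phi> t)))"
      unfolding \<Phi>_def keys_var_times
      by (subst sum.reindex) (auto simp: inj_on_def lookup_var_times \<phi>_var)
    also have "\<dots> = X i (\<Phi> f)"
      unfolding X_def \<Phi>_def sum_distrib_left NF_sum scale_poly_mult NF_scale ..
    finally show ?case using var by (simp add: X_def)
  qed
  have "f = NF G f" using f(2) by (intro NF_id[symmetric]) auto
  also have "\<dots> = \<Phi> f" using f(2) by (intro \<Phi>_U[symmetric]) auto
  also have "\<dots> = 0" by (rule \<Phi>_ideal[OF f(1)])
  finally show ?thesis .
qed

end

section \<open>Border bases of the leading term complement\<close>

context degree_ordering
begin

lemma notin_LT_complement_iff: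
  "t \<notin> LT_complement \<sigma> I \<longleftrightarrow> (\<exists>f\<in>I. f \<noteq> 0 \<and> LT \<sigma> f = t)"
  by (auto simp: LT_complement_def)

text \<open>The leading term is either kept, if it is in \<open>S\<close>, or cancelled by an element of the ideal;
  the rest has a smaller leading term. A leading term in \<open>S\<close> survives because everything added
  later is smaller.\<close>

lemma reduction_modulo_ideal:
  fixes F :: "('x, 'k::field) mpoly set"
  assumes lead: "\<forall>t. t \<notin> S \<longrightarrow> (\<exists>g\<in>ideal_generated F. g \<noteq> 0 \<and> LT \<sigma> g = t)"
  shows "\<exists>h. Poly_Mapping.keys h \<subseteq> S \<and> f - h \<in> ideal_generated F \<and>
    (\<forall>s\<in>Poly_Mapping.keys h. \<exists>r\<in>Poly_Mapping.keys f. (s, r) \<in> \<sigma>) \<and>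
    (f \<noteq> 0 \<longrightarrow> LT \<sigma> f \<in> S \<longrightarrow> LT \<sigma> f \<in> Poly_Mapping.keys h)"
proof (induction "if f = 0 then 0 else Suc (rank (LT \<sigma> f))" arbitrary: f rule: less_induct)
  case less
  show ?case
  proof (cases "f = 0")
    case True
    then show ?thesis by (intro exI[of _ 0]) (simp add: ideal.span_zero)
  next
    case False
    define t c where "t = LT \<sigma> f" and "c = Poly_Mapping.lookup f t"
    have c: "c \<noteq> 0" using LT_in_keys[OF False] by (simp add: c_def t_def in_keys_iff)
    have step: "\<exists>h. Poly_Mapping.keys h \<subseteq> S \<and> f - q - h \<in> ideal_generated F \<and>
        (\<forall>s\<in>Poly_Mapping.keys h. (s, t) \<in> \<sigma> \<and> s \<noteq> t)"
      if q: "Poly_Mapping.lookup q t = c" "\<And>s. s \<in> Poly_Mapping.keys q \<Longrightarrow> (s, t) \<in> \<sigma>" for q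
    proof -
      have below: "(s, t) \<in> \<sigma> \<and> s \<noteq> t" if s: "s \<in> Poly_Mapping.keys (f - q)" for s
      proof
        show "(s, t) \<in> \<sigma>" using s keys_minus_subset[of f q] q(2) LT_max[of s f] by (auto simp: t_def)
        show "s \<noteq> t" using s q(1) by (auto simp: in_keys_iff lookup_minus c_def)
      qed
      have "f - q \<noteq> 0 \<Longrightarrow> rank (LT \<sigma> (f - q)) < rank (LT \<sigma> f)"
        using below[OF LT_in_keys] rank_less by (simp add: t_def)
      then obtain h where h: "Poly_Mapping.keys h \<subseteq> S" "f - q - h \<in> ideal_generated F"
          "\<forall>s\<in>Poly_Mapping.keys h. \<exists>r\<in>Poly_Mapping.keys (f - q). (s, r) \<in> \<sigma>"
        using less[of "f - q"] False by (force split: if_splits)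
      have "(s, t) \<in> \<sigma> \<and> s \<noteq> t" if "s \<in> Poly_Mapping.keys h" for s
        using h(3) that below le_trans le_antisym by metis
      then show ?thesis using h by blast
    qed
    have t_keys: "t \<in> Poly_Mapping.keys f" using LT_in_keys[OF False] by (simp add: t_def)
    show ?thesis
    proof (cases "t \<in> S")
      case True
      obtain h where h: "Poly_Mapping.keys h \<subseteq> S" "f - monomial c t - h \<in> ideal_generated F"
          "\<forall>s\<in>Poly_Mapping.keys h. (s, t) \<in> \<sigma> \<and> s \<noteq> t"
        using step[of "monomial c t"] by (auto simp: lookup_monomial keys_monomial c)
      have keys: "Poly_Mapping.keys (monomial c t + h) \<subseteq> insert t (Poly_Mapping.keys h)"
        using keys_add[of "monomial c t" h] by (auto simp: keys_monomial split: if_splits)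
      have "t \<notin> Poly_Mapping.keys h" using h(3) by auto
      then have "t \<in> Poly_Mapping.keys (monomial c t + h)"
        using c by (simp add: in_keys_iff lookup_add lookup_monomial)
      moreover have "f - (monomial c t + h) \<in> ideal_generated F"
        using h(2) by (simp add: diff_diff_eq)
      moreover have "Poly_Mapping.keys (monomial c t + h) \<subseteq> S"
        and "\<forall>s\<in>Poly_Mapping.keys (monomial c t + h). (s, t) \<in> \<sigma>"
        using keys h(1,3) True by auto
      ultimately show ?thesis using t_keys unfolding t_def[symmetric] by blast
    next
      case False
      then obtain g where g: "g \<in> ideal_generated F" "g \<noteq> 0" "LT \<sigma> g = t" using lead by blast
      define a where "a = Poly_Mapping.lookup g t"
      have a: "a \<noteq> 0" using LT_in_keys[OF g(2)] g(3) by (simp add: a_def in_keys_iff)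
      let ?q = "scale_poly (c / a) g"
      have q: "?q \<in> ideal_generated F" unfolding scale_poly_def by (rule ideal.span_scale[OF g(1)])
      have "s \<in> Poly_Mapping.keys ?q \<Longrightarrow> (s, t) \<in> \<sigma>" for s
        using keys_scale_subset[of "c / a" g] LT_max[of s g] g(3) by auto
      then obtain h where h: "Poly_Mapping.keys h \<subseteq> S" "f - ?q - h \<in> ideal_generated F"
          "\<forall>s\<in>Poly_Mapping.keys h. (s, t) \<in> \<sigma> \<and> s \<noteq> t"
        using step[of ?q] a by (auto simp: lookup_scale a_def)
      have "f - h = (f - ?q - h) + ?q" by simp
      then have "f - h \<in> ideal_generated F" using ideal.span_add[OF h(2) q] by metis
      then show ?thesis
        using h False t_keys unfolding t_def[symmetric] by blast
    qed
  qed
qed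

text \<open>Reducing an element of the ideal with leading term in \<open>S\<close> would produce a nonzero element of
  the ideal that is supported in \<open>S\<close>.\<close>

lemma LT_complement_residue_basis:
  fixes F :: "('x, 'k::field) mpoly set"
  assumes S: "finite S"
    and lead: "\<forall>t. t \<notin> S \<longrightarrow> (\<exists>g\<in>ideal_generated F. g \<noteq> 0 \<and> LT \<sigma> g = t)"
    and indep: "\<forall>f\<in>ideal_generated F. Poly_Mapping.keys f \<subseteq> S \<longrightarrow> f = 0"
  shows "S = LT_complement \<sigma> (ideal_generated F)" and "residue_basis S (ideal_generated F)"
proof -
  have "LT \<sigma> f \<notin> S" if f: "f \<in> ideal_generated F" "f \<noteq> 0" for f
  proof
    assume "LT \<sigma> f \<in> S"
    then obtain h where h: "Poly_Mapping.keys h \<subseteq> S" "f - h \<in> ideal_generated F" "h \<noteq> 0"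
      using reduction_modulo_ideal[OF lead, of f] f(2) by fastforce
    have "h = f - (f - h)" by simp
    then have "h \<in> ideal_generated F" using ideal.span_diff[OF f(1) h(2)] by metis
    then show False using indep h by blast
  qed
  then have "t \<in> S \<longleftrightarrow> t \<in> LT_complement \<sigma> (ideal_generated F)" for t
    using lead notin_LT_complement_iff[of t "ideal_generated F"] by metis
  then show "S = LT_complement \<sigma> (ideal_generated F)" by blast
  show "residue_basis S (ideal_generated F)"
    unfolding residue_basis_def
  proof (intro conjI allI impI ballI)
    fix f :: "('x, 'k) mpoly"
    obtain h where h: "Poly_Mapping.keys h \<subseteq> S" "f - h \<in> ideal_generated F"
      using reduction_modulo_ideal[OF lead, of f] by auto
    then show "\<exists>c. f - (\<Sum>t\<in>S. monomial (c t) t) \<in> ideal_generated F"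
      using poly_eq_sum_monomials_superset[OF S h(1)] by metis
  next
    fix c t assume "(\<Sum>t\<in>S. monomial (c t) t) \<in> ideal_generated F" and t: "t \<in> S"
    then have "(\<Sum>t\<in>S. monomial (c t) t) = 0" using indep keys_sum_monomials by blast
    then show "c t = 0" using lookup_sum_monomials[OF S, of c t] t by simp
  qed
qed

text \<open>Terms that are not leading terms of the ideal are linearly independent modulo the ideal, so
  there are at most as many as generators of the residue class space.\<close>

lemma finite_LT_complement:
  fixes F :: "('x, 'k::field) mpoly set"
  assumes "zero_dimensional (ideal_generated F)"
  shows "finite (LT_complement \<sigma> (ideal_generated F))"
proof -
  let ?I = "ideal_generated F" and ?L = "LT_complement \<sigma> (ideal_generated F)"
  obtain B where B: "finite B" "\<And>f. \<exists>g\<in>K_span B. f - g \<in> ?I"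
    using assms by (auto simp: zero_dimensional_def)
  have "\<forall>t. \<exists>g. g \<in> K_span B \<and> monomial 1 t - g \<in> ?I" using B(2) by blast
  then obtain q where q: "\<And>t. q t \<in> K_span B" "\<And>t. monomial 1 t - q t \<in> ?I"
    by metis
  have indep: "\<forall>s\<in>A. c s = 0"
    if A: "finite A" "A \<subseteq> ?L" and 0: "(\<Sum>s\<in>A. scale_poly (c s) (q s)) = 0" for A c
  proof -
    let ?f = "\<Sum>s\<in>A. monomial (c s) s"
    have "?f = (\<Sum>s\<in>A. scale_poly (c s) (monomial 1 s - q s))"
      unfolding poly_vs.scale_right_diff_distrib sum_subtractf 0 by (simp add: scale_monomial)
    also have "\<dots> \<in> ?I"
      unfolding scale_poly_def using q(2) by (intro ideal.span_sum ideal.span_scale)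
    finally have f: "?f \<in> ?I" .
    have "?f = 0"
    proof (rule ccontr)
      assume nz: "?f \<noteq> 0"
      then have "LT \<sigma> ?f \<in> ?L" using LT_in_keys keys_sum_monomials A(2) by blast
      then show False using notin_LT_complement_iff[of _ ?I] f nz by blast
    qed
    then show ?thesis using lookup_sum_monomials[OF A(1), of c] by (metis lookup_zero)
  qed
  have inj: "inj_on q ?L"
  proof (rule inj_onI, rule ccontr)
    fix s t assume st: "s \<in> ?L" "t \<in> ?L" "q s = q t" "s \<noteq> t"
    then show False
      using indep[of "{s, t}" "\<lambda>u. if u = s then 1 else -1"] by (simp split: if_splits)
  qed
  have "\<not> poly_vs.dependent (q ` ?L)"
    unfolding poly_vs.dependent_explicit
  proof (rule notI, elim exE conjE bexE)
    fix T u v assume T: "finite T" "T \<subseteq> q ` ?L" "(\<Sum>v\<in>T. scale_poly (u v) v) = 0" "v \<in> T" "u v \<noteq> 0"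
    from finite_subset_image[OF T(1,2)]
    obtain A where A: "A \<subseteq> ?L" "finite A" "T = q ` A" by blast
    then have "(\<Sum>s\<in>A. scale_poly (u (q s)) (q s)) = 0"
      using T(3) sum.reindex[OF inj_on_subset[OF inj A(1)], of "\<lambda>v. scale_poly (u v) v"] by simp
    from indep[OF A(2,1) this] show False using T(4,5) A(3) by auto
  qed
  then have "finite (q ` ?L)"
    using poly_vs.independent_span_bound[OF B(1)] q(1) by blast
  then show ?thesis using inj finite_imageD by blast
qed

text \<open>The situation in which (T7) is reached.\<close>

definition stabilized :: "('x, 'k::field) mpoly set \<Rightarrow> 'x pterm set \<Rightarrow> ('x, 'k) mpoly set \<Rightarrow> bool" where
  "stabilized F U G \<longleftrightarrow> reduced G \<and> supp_set G \<subseteq> U \<and> stable U G \<and> order_ideal U \<and> F \<subseteq> K_span G"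

text \<open>A representation of \<open>f\<close> in terms of the generators involves only products up to some degree
  \<open>D\<close>. If \<open>U\<close> contains all terms up to degree \<open>D\<close>, then by stability none of these products leaves the
  span of \<open>G\<close>. The bound has to be uniform in \<open>U\<close> and \<open>G\<close>, as these change during the execution.\<close>

lemma ideal_element_in_span:
  fixes F :: "('x, 'k::field) mpoly set"
  assumes "f \<in> ideal_generated F"
  shows "\<exists>D. \<forall>U G. stabilized F U G \<longrightarrow> terms_upto D \<subseteq> U \<longrightarrow> f \<in> K_span G"
  using assms
proof (induction rule: ideal_generated_induct)
  case zero
  show ?case by (simp add: poly_vs.span_zero)
next
  case (base g)
  then show ?case unfolding stabilized_def by blast
next
  case (add f g)
  then obtain D E where D: "\<forall>U G. stabilized F U G \<longrightarrow> terms_upto D \<subseteq> U \<longrightarrow> f \<in> K_span G"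
    and E: "\<forall>U G. stabilized F U G \<longrightarrow> terms_upto E \<subseteq> U \<longrightarrow> g \<in> K_span G" by blast
  have "terms_upto D \<subseteq> terms_upto (max D E)" "terms_upto E \<subseteq> terms_upto (max D E)"
    by (simp_all add: terms_upto_mono)
  then show ?case using D E by (intro exI[of _ "max D E"]) (blast intro: poly_vs.span_add)
next
  case (scale c f)
  then show ?case by (meson poly_vs.span_scale)
next
  case (var i f)
  then obtain D where D: "\<forall>U G. stabilized F U G \<longrightarrow> terms_upto D \<subseteq> U \<longrightarrow> f \<in> K_span G" by blast
  let ?E = "deg_term (LT \<sigma> (var_poly i * f))"
  have sub: "terms_upto D \<subseteq> terms_upto (max D ?E)" "terms_upto ?E \<subseteq> terms_upto (max D ?E)"
    by (simp_all add: terms_upto_mono)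
  show ?case
  proof (intro exI[of _ "max D ?E"] allI impI)
    fix U G assume *: "stabilized F U G" and U: "terms_upto (max D ?E) \<subseteq> U"
    have "f \<in> K_span G" using D * U sub(1) by blast
    then have "var_poly i * f \<in> K_span (polys_plus G)" by (rule var_times_K_span)
    moreover have "Poly_Mapping.keys (var_poly i * f) \<subseteq> U"
      using keys_subset_upto_LT sub(2) U by (meson order_trans)
    ultimately show "var_poly i * f \<in> K_span G"
      using * stable_span unfolding stabilized_def by blast
  qed
qed

text \<open>Let all elements of \<open>\<O>\<^sub>\<sigma>{I}\<close> have degree at most \<open>e\<close>. Each term \<open>t\<close> of degree \<open>e + 1\<close> is the
  leading term of some \<open>f\<^sub>t\<close> in the ideal, and for large \<open>D\<close> all the \<open>f\<^sub>t\<close> lie in the span of \<open>G\<close>. So the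
  order ideal \<open>U - LT \<sigma> ` G\<close> has no terms of degree \<open>e + 1\<close>, hence none of higher degree, and its
  border has degree at most \<open>e + 1\<close>.\<close>

theorem border_bound:
  fixes F :: "('x, 'k::field) mpoly set"
  assumes "zero_dimensional (ideal_generated F)"
  obtains D where
    "\<And>U G. stabilized F U G \<Longrightarrow> terms_upto D \<subseteq> U \<Longrightarrow> border (U - LT \<sigma> ` G) \<subseteq> U"
proof -
  let ?L = "LT_complement \<sigma> (ideal_generated F)"
  have "finite ?L" using assms by (rule finite_LT_complement)
  then have "\<exists>e. ?L \<subseteq> terms_upto e"
    by (intro exI[of _ "Max (deg_term ` ?L)"]) (auto simp: terms_upto_def)
  then obtain e where e: "?L \<subseteq> terms_upto e" by blast
  define A where "A = terms_upto (Suc e) - ?L"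
  have A: "finite A" by (simp add: A_def)
  have "\<exists>f E. f \<noteq> 0 \<and> LT \<sigma> f = t \<and> (\<forall>U G. stabilized F U G \<longrightarrow> terms_upto E \<subseteq> U \<longrightarrow> f \<in> K_span G)" if "t \<in> A" for t
    using that notin_LT_complement_iff[of t "ideal_generated F"] ideal_element_in_span
    unfolding A_def by blast
  then obtain f E where f: "\<And>t. t \<in> A \<Longrightarrow> f t \<noteq> 0 \<and> LT \<sigma> (f t) = t"
    and E: "\<And>t U G. t \<in> A \<Longrightarrow> stabilized F U G \<Longrightarrow> terms_upto (E t) \<subseteq> U \<Longrightarrow> f t \<in> K_span G"
    by metis
  define D where "D = Suc e + (\<Sum>t\<in>A. E t)"
  have D: "Suc e \<le> D" "\<And>t. t \<in> A \<Longrightarrow> E t \<le> D"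
    using A member_le_sum[of _ A E] by (auto simp: D_def intro: le_SucI trans_le_add2)
  show thesis
  proof (rule that)
    fix U G assume st: "stabilized F U G" and DU: "terms_upto D \<subseteq> U"
    then have G: "reduced G" "stable U G" and U: "order_ideal U" by (auto simp: stabilized_def)
    let ?S = "U - LT \<sigma> ` G"
    have "0 \<notin> G" using G(1) by (auto simp: reduced_def)
    then have S: "order_ideal ?S" using U G(2) by (intro stable_order_ideal)
    have "A \<subseteq> LT \<sigma> ` G"
    proof
      fix t assume t: "t \<in> A"
      have "terms_upto (E t) \<subseteq> U" using terms_upto_mono[OF D(2)[OF t]] DU by blast
      from E[OF t st this] show "t \<in> LT \<sigma> ` G" using reduced_LT_span[OF G(1)] f[OF t] by metis
    qed
    have "?S \<subseteq> terms_upto e"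
    proof (rule subsetI, rule ccontr)
      fix t assume t: "t \<in> ?S" "t \<notin> terms_upto e"
      then have "Suc e \<le> deg_term t" by (simp add: terms_upto_def)
      from ex_divisor_of_degree[OF this] obtain s where s: "term_dvd s t" "deg_term s = Suc e" by blast
      have "s \<in> ?S" using S t(1) s(1) unfolding order_ideal_def by blast
      moreover have "s \<in> A" using s(2) e by (auto simp: A_def terms_upto_def)
      ultimately show False using \<open>A \<subseteq> LT \<sigma> ` G\<close> by blast
    qed
    then have "border ?S \<subseteq> terms_upto (Suc e)" by (rule border_subset_upto)
    then show "border ?S \<subseteq> U" using terms_upto_mono[OF D(1)] DU by blast
  qed
qed

text \<open>A term outside of \<open>S = U - LT \<sigma> ` G\<close> is a multiple of a border term, and the border terms are
  leading terms of \<open>G\<close>; so \<open>S\<close> contains \<open>\<O>\<^sub>\<sigma>{I}\<close>. The converse and linear independence follow since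
  no nonzero element of the ideal is supported in \<open>S\<close>. The border prebasis shape is the reducedness
  of \<open>G\<close>.\<close>

theorem stable_border_basis:
  fixes F :: "('x, 'k::field) mpoly set"
  assumes st: "stabilized F U G" and G_ideal: "G \<subseteq> ideal_generated F" and ne: "U \<noteq> {}"
    and bd: "border (U - LT \<sigma> ` G) \<subseteq> U"
  shows "U - LT \<sigma> ` G = LT_complement \<sigma> (ideal_generated F)"
    and "is_border_basis (U - LT \<sigma> ` G) {g \<in> G. LT \<sigma> g \<in> border (U - LT \<sigma> ` G)} (ideal_generated F)"
proof -
  have G: "reduced G" "supp_set G \<subseteq> U" "stable U G" and U: "order_ideal U" "U \<noteq> {}"
    and FG: "F \<subseteq> K_span G" "G \<subseteq> ideal_generated F"
    using st G_ideal ne by (auto simp: stabilized_def)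
  define S where "S = U - LT \<sigma> ` G"
  let ?I = "ideal_generated F"
  have "0 \<notin> G" using G(1) by (auto simp: reduced_def)
  then have S: "order_ideal S" unfolding S_def using U G(3) by (intro stable_order_ideal)
  then have fin: "finite S" by (simp add: order_ideal_def)
  have border_LT: "\<exists>g\<in>G. LT \<sigma> g = b" if "b \<in> border S" for b
  proof -
    have "b \<notin> S" using that by (auto simp: border_def split: if_splits)
    then show ?thesis using that bd by (auto simp: S_def)
  qed
  have lead: "\<forall>t. t \<notin> S \<longrightarrow> (\<exists>g\<in>?I. g \<noteq> 0 \<and> LT \<sigma> g = t)"
  proof (intro allI impI)
    fix t assume t: "t \<notin> S"
    obtain b where b: "b \<in> border S" "term_dvd b t" using dvd_border[OF S t] by blast
    obtain g where g: "g \<in> G" "LT \<sigma> g = b" using border_LT[OF b(1)] by blast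
    obtain u where u: "t = b + u" using b(2) by (auto simp: term_dvd_def)
    have nz: "g \<noteq> 0" using g(1) G(1) by (auto simp: reduced_def)
    have LT: "LT \<sigma> (monomial 1 u * g) = t" using LT_monomial_times[OF nz] g(2) u by (simp add: add.commute)
    have "Poly_Mapping.lookup (monomial 1 u * g) (u + b) \<noteq> 0"
      using LT_in_keys[OF nz] g(2) by (simp add: lookup_monomial_times in_keys_iff)
    then have "monomial 1 u * g \<noteq> 0" by auto
    moreover have "monomial 1 u * g \<in> ?I" using g(1) FG(2) by (intro ideal.span_scale) auto
    ultimately show "\<exists>g\<in>?I. g \<noteq> 0 \<and> LT \<sigma> g = t" using LT by blast
  qed
  have "F \<subseteq> ideal_generated G"
    using FG(1) K_span_subset_ideal[of G G] ideal.span_superset by blast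
  then have "?I \<subseteq> ideal_generated G" using ideal.subspace_span by (rule ideal.span_minimal)
  then have indep: "\<forall>f\<in>?I. Poly_Mapping.keys f \<subseteq> S \<longrightarrow> f = 0"
    using stable_ideal_normal_form[OF G(1,2,3) U bd] unfolding S_def by blast
  show "U - LT \<sigma> ` G = LT_complement \<sigma> ?I"
    using LT_complement_residue_basis(1)[OF fin lead indep] by (simp add: S_def)
  have res: "residue_basis S ?I"
    by (rule LT_complement_residue_basis(2)[OF fin lead indep])
  from border_LT obtain g where g: "\<And>b. b \<in> border S \<Longrightarrow> g b \<in> G \<and> LT \<sigma> (g b) = b" by metis
  have g_eq: "{g \<in> G. LT \<sigma> g \<in> border S} = g ` border S"
    using g reduced_LT_inj[OF G(1)] by (auto simp: image_iff) metis
  have shape: "g b = monomial 1 b - (\<Sum>t\<in>S. monomial (- Poly_Mapping.lookup (g b) t) t)"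
    if b: "b \<in> border S" for b
  proof (rule poly_mapping_eqI)
    fix t
    have gb: "g b \<in> G" "LT \<sigma> (g b) = b" using g[OF b] by auto
    have "b \<notin> S" using b by (auto simp: border_def split: if_splits)
    moreover have "Poly_Mapping.lookup (g b) b = 1" using reduced_lookup[OF G(1) gb(1,1)] gb(2) by simp
    moreover have "Poly_Mapping.lookup (g b) t = 0" if t: "t \<notin> S" "t \<noteq> b"
    proof (rule ccontr)
      assume nz: "Poly_Mapping.lookup (g b) t \<noteq> 0"
      then have "t \<in> U" using gb(1) G(2) unfolding supp_set_def by (auto simp flip: in_keys_iff)
      then obtain h where h: "h \<in> G" "t = LT \<sigma> h" using t(1) by (auto simp: S_def)
      then show False using reduced_lookup[OF G(1) gb(1) h(1)] nz t(2) gb(2) by (metis (full_types))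
    qed
    ultimately show "Poly_Mapping.lookup (g b) t
        = Poly_Mapping.lookup (monomial 1 b - (\<Sum>t\<in>S. monomial (- Poly_Mapping.lookup (g b) t) t)) t"
      unfolding lookup_minus lookup_sum_monomials[OF fin] lookup_monomial by auto
  qed
  show "is_border_basis (U - LT \<sigma> ` G) {g \<in> G. LT \<sigma> g \<in> border (U - LT \<sigma> ` G)} ?I"
    unfolding is_border_basis_def S_def[symmetric]
  proof (intro conjI)
    show "\<exists>g' \<alpha>. {g \<in> G. LT \<sigma> g \<in> border S} = g' ` border S \<and>
        (\<forall>b\<in>border S. g' b = monomial 1 b - (\<Sum>t\<in>S. monomial (\<alpha> t b) t))"
      using g_eq shape
      by (intro exI[of _ g] exI[of _ "\<lambda>t b. - Poly_Mapping.lookup (g b) t"]) blast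
  qed (use S res FG(2) in auto)
qed

end

section \<open>The states of an execution\<close>

lemma ex_term_enumeration:
  "\<exists>ts. term_enumeration (hs :: ('x::finite, 'k::zero) marked list) ts"
proof -
  have "finite (supp_set (fst ` set hs))" by (simp add: supp_set_def)
  then obtain us where us: "set us = supp_set (fst ` set hs)" "distinct us"
    using finite_distinct_list by blast
  let ?ts = "rev (sort_key deg_term us)"
  have "sorted_wrt (\<lambda>t t'. deg_term t \<ge> deg_term t') ?ts"
    using sorted_sort_key[of deg_term us] by (simp add: sorted_wrt_rev sorted_wrt_map)
  then have "term_enumeration hs ?ts" unfolding term_enumeration_def using us by simp
  then show ?thesis by blast
qed

context degree_ordering
begin

text \<open>The part of the invariant that holds at every point of the loop. Since \<open>F\<close> is in the span of
  \<open>G\<close> and \<open>G\<close> in the ideal of \<open>F\<close>, both generate the same ideal.\<close>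

definition sound :: "('x, 'k::field) mpoly set \<Rightarrow> 'x pterm set \<Rightarrow> ('x, 'k) mpoly set \<Rightarrow> bool" where
  "sound F U G \<longleftrightarrow> reduced G \<and> supp_set G \<subseteq> U \<and> order_ideal U \<and> U \<noteq> {} \<and>
     F \<subseteq> K_span G \<and> G \<subseteq> ideal_generated F"

text \<open>In the state between (T3) and (T6), \<open>H\<close> is the echelon form of the prolongation of \<open>G\<close>. The
  iterations of (T4) and (T5) change only \<open>U\<close>.\<close>

primrec invariant :: "('x, 'k::field) mpoly set \<Rightarrow> ('x, 'k) bba_state \<Rightarrow> bool" where
  "invariant F (Input V) \<longleftrightarrow> V = mark ` F"
| "invariant F (At_T3 V U) \<longleftrightarrow> (\<exists>G. V = mark ` G \<and> sound F U G)"
| "invariant F (At_T4 V U V' W') \<longleftrightarrow>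
     (\<exists>G H. V = mark ` G \<and> sound F U G \<and> reduced H \<and> K_span H = K_span (polys_plus G) \<and>
        V' = mark ` {h \<in> H. LT \<sigma> h \<in> LT \<sigma> ` G} \<and> W' = mark ` {h \<in> H. LT \<sigma> h \<notin> LT \<sigma> ` G})"
| "invariant F (At_T7 V U) \<longleftrightarrow> (\<exists>G. V = mark ` G \<and> sound F U G \<and> stable U G)"
| "invariant F Failed \<longleftrightarrow> False"
| "invariant F (Output V S) \<longleftrightarrow>
     S = LT_complement \<sigma> (ideal_generated F) \<and> is_border_basis S (fst ` V) (ideal_generated F)"

lemma sound_stable: "sound F U G \<Longrightarrow> stable U G \<Longrightarrow> stabilized F U G"
  by (simp add: sound_def stabilized_def)

lemma sound_LT_subset: "sound F U G \<Longrightarrow> LT \<sigma> ` G \<subseteq> U"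
  using LT_in_keys unfolding sound_def reduced_def supp_set_def by blast

lemma sound_mono: "sound F U G \<Longrightarrow> order_ideal U' \<Longrightarrow> U \<subseteq> U' \<Longrightarrow> sound F U' G"
  unfolding sound_def by blast

text \<open>Restricting the echelon form of the prolongation to the leading terms in \<open>U\<close> loses nothing of
  the span of \<open>G\<close>: the coordinates of \<open>g \<in> G\<close> in that echelon form are its coefficients at leading
  terms, and the support of \<open>g\<close> is contained in \<open>U\<close>.\<close>

lemma extension_span:
  assumes ok: "sound F U G" and H: "reduced H" "K_span H = K_span (polys_plus G)"
  shows "G \<subseteq> K_span {h \<in> H. LT \<sigma> h \<in> U}"
proof
  fix g assume g: "g \<in> G"
  then have "g \<in> K_span H" using H(2) polys_plus_superset poly_vs.span_base by blast
  then have "g = (\<Sum>h\<in>H. scale_poly (Poly_Mapping.lookup g (LT \<sigma> h)) h)"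
    by (rule reduced_expansion[OF H(1)])
  also have "\<dots> \<in> K_span {h \<in> H. LT \<sigma> h \<in> U}"
  proof (rule poly_vs.span_sum)
    fix h assume h: "h \<in> H"
    show "scale_poly (Poly_Mapping.lookup g (LT \<sigma> h)) h \<in> K_span {h \<in> H. LT \<sigma> h \<in> U}"
    proof (cases "LT \<sigma> h \<in> U")
      case True
      then show ?thesis using h by (intro poly_vs.span_scale poly_vs.span_base) simp
    next
      case False
      moreover have "Poly_Mapping.keys g \<subseteq> U" using ok g by (auto simp: sound_def supp_set_def)
      ultimately have "Poly_Mapping.lookup g (LT \<sigma> h) = 0" by (auto simp flip: not_in_keys_iff_lookup_eq_zero)
      then show ?thesis by (simp add: poly_vs.span_zero)
    qed
  qed
  finally show "g \<in> K_span {h \<in> H. LT \<sigma> h \<in> U}" .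
qed

text \<open>The supports of the elements with an old leading term stay in \<open>U\<close> as well: such an element
  differs from the old one by a combination of elements with smaller leading terms in \<open>U\<close>.\<close>

lemma extension_support:
  assumes ok: "sound F U G" and H: "reduced H" "K_span H = K_span (polys_plus G)"
    and new: "supp_set {h \<in> H. LT \<sigma> h \<notin> LT \<sigma> ` G \<and> LT \<sigma> h \<in> U} \<subseteq> U"
  shows "supp_set {h \<in> H. LT \<sigma> h \<in> U} \<subseteq> U"
proof -
  have "Poly_Mapping.keys h \<subseteq> U" if "h \<in> H" "LT \<sigma> h \<in> U" for h
    using that
  proof (induction "rank (LT \<sigma> h)" arbitrary: h rule: less_induct)
    case less
    show ?case
    proof (cases "LT \<sigma> h \<in> LT \<sigma> ` G")
      case False
      then show ?thesis using new less.prems unfolding supp_set_def by blast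
    next
      case True
      then obtain g where g: "g \<in> G" "LT \<sigma> g = LT \<sigma> h" by auto
      have finH: "finite H" using H(1) by (simp add: reduced_def)
      have "Poly_Mapping.lookup g (LT \<sigma> g) = 1" "Poly_Mapping.keys g \<subseteq> U"
        using ok g(1) by (auto simp: sound_def reduced_def supp_set_def)
      then have one: "Poly_Mapping.lookup g (LT \<sigma> h) = 1" and gU: "Poly_Mapping.keys g \<subseteq> U"
        using g(2) by auto
      let ?r = "\<Sum>k\<in>H - {h}. scale_poly (Poly_Mapping.lookup g (LT \<sigma> k)) k"
      have "g \<in> K_span H" using g(1) H(2) polys_plus_superset poly_vs.span_base by blast
      then have "g = (\<Sum>k\<in>H. scale_poly (Poly_Mapping.lookup g (LT \<sigma> k)) k)"
        by (rule reduced_expansion[OF H(1)])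
      also have "\<dots> = h + ?r"
        using sum.remove[OF finH less.prems(1), of "\<lambda>k. scale_poly (Poly_Mapping.lookup g (LT \<sigma> k)) k"] one
        by simp
      finally have "h = g - ?r" by (simp add: algebra_simps)
      moreover have "Poly_Mapping.keys ?r \<subseteq> U"
      proof (rule order_trans[OF keys_sum_subset], rule UN_least)
        fix k assume k: "k \<in> H - {h}"
        show "Poly_Mapping.keys (scale_poly (Poly_Mapping.lookup g (LT \<sigma> k)) k) \<subseteq> U"
        proof (cases "Poly_Mapping.lookup g (LT \<sigma> k) = 0")
          case False
          then have kg: "LT \<sigma> k \<in> Poly_Mapping.keys g" by (simp add: in_keys_iff)
          have "LT \<sigma> k \<noteq> LT \<sigma> h" using reduced_LT_inj[OF H(1)] k less.prems(1) by blast
          then have "rank (LT \<sigma> k) < rank (LT \<sigma> h)"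
            using LT_max[OF kg] g(2) rank_less by simp
          then have "Poly_Mapping.keys k \<subseteq> U" using less.hyps k kg gU by blast
          then show ?thesis using keys_scale_subset by blast
        qed simp
      qed
      ultimately show ?thesis using gU keys_minus_subset[of g ?r] by auto
    qed
  qed
  then show ?thesis unfolding supp_set_def by blast
qed

text \<open>The set with which (T6) returns to (T3) consists of the elements of \<open>H\<close> with leading term in
  \<open>U\<close>, both old and new ones, because the old leading terms are all in \<open>U\<close>.\<close>

lemma sound_extension:
  assumes ok: "sound F U G" and H: "reduced H" "K_span H = K_span (polys_plus G)"
    and new: "supp_set {h \<in> H. LT \<sigma> h \<notin> LT \<sigma> ` G \<and> LT \<sigma> h \<in> U} \<subseteq> U"
  shows "sound F U {h \<in> H. LT \<sigma> h \<in> U}"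
proof -
  let ?G' = "{h \<in> H. LT \<sigma> h \<in> U}"
  have "reduced ?G'" by (rule reduced_subset[OF H(1)]) auto
  moreover have "F \<subseteq> K_span ?G'"
    using ok extension_span[OF ok H] poly_vs.span_minimal[OF _ poly_vs.subspace_span]
    unfolding sound_def by blast
  moreover have "H \<subseteq> ideal_generated F"
  proof -
    have "polys_plus G \<subseteq> ideal_generated F"
      using ok by (intro polys_plus_subset_ideal) (simp add: sound_def)
    then show ?thesis using K_span_subset_ideal H(2) poly_vs.span_superset by blast
  qed
  ultimately show ?thesis
    using ok extension_support[OF ok H new] unfolding sound_def by blast
qed

lemma stable_if_no_extension:
  assumes H: "reduced H" "K_span H = K_span (polys_plus G)"
    and none: "\<And>h. h \<in> H \<Longrightarrow> LT \<sigma> h \<in> U \<Longrightarrow> LT \<sigma> h \<in> LT \<sigma> ` G"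
  shows "stable U G"
  unfolding stable_def using reduced_LT_span[OF H(1)] H(2) none by (metis imageE)

lemma marked_extension_LT:
  assumes G: "0 \<notin> G" and ext: "marked_extension (mark ` G) ys" and m: "m \<in> set ys"
  shows "fst m \<noteq> 0 \<and> snd m = LT \<sigma> (fst m)"
proof -
  obtain h t' where ht: "m = (h, t')" by fastforce
  then obtain v i where v: "v \<in> G" "h = var_poly i * v" "t' = var_term i + LT \<sigma> v"
    using ext m by (fastforce simp: marked_extension_def mark_def)
  then have "v \<noteq> 0" using G by auto
  then show ?thesis using v ht by (simp add: LT_var_times var_times_eq_0_iff)
qed

lemma T3_interreduction:
  assumes ok: "sound F U G" and xs: "set xs = mark ` G" and ext: "marked_extension (mark ` G) ys"
    and ts: "term_enumeration (xs @ ys) ts" "sorted_wrt (term_gt \<sigma>) ts"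
  obtains H where "marked_interreduction (xs @ ys) ts = mark ` H" and "reduced H"
    and "K_span H = K_span (polys_plus G)"
proof -
  have G: "0 \<notin> G" using ok by (auto simp: sound_def reduced_def)
  have "fst m \<noteq> 0 \<and> snd m = LT \<sigma> (fst m)" if "m \<in> set (xs @ ys)" for m
  proof (cases "m \<in> set ys")
    case False
    then show ?thesis using that xs G by (auto simp: mark_def)
  qed (rule marked_extension_LT[OF G ext])
  from marked_interreduction_reduced[OF this ts] obtain H
    where H: "marked_interreduction (xs @ ys) ts = mark ` H" "reduced H" "K_span H = K_span (fst ` set (xs @ ys))"
    by blast
  have "fst ` set ys = polys_plus G - G" using ext by (simp add: marked_extension_def)
  then have "fst ` set (xs @ ys) = polys_plus G"
    using xs polys_plus_superset[of G] by (auto simp: image_Un)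
  then show thesis using that H by simp
qed

text \<open>The zero ideal is not zero-dimensional, as there is at least one indeterminate. This excludes
  the empty input, for which \<open>U\<close> would be empty.\<close>

lemma zero_dimensional_nonempty:
  assumes "zero_dimensional (ideal_generated F)" shows "F \<noteq> ({} :: ('x, 'k::field) mpoly set)"
proof
  assume "F = {}"
  then have "LT_complement \<sigma> (ideal_generated F) = UNIV" by (simp add: LT_complement_def)
  then show False using finite_LT_complement[OF assms] by (simp add: infinite_terms)
qed

lemma bba_step_invariant:
  fixes F :: "('x, 'k::field) mpoly set"
  assumes F: "finite F" "0 \<notin> F" "F \<noteq> {}" and inv: "invariant F s" and step: "bba_step s lb s'"
    and sorted: "\<And>hs ts. lb = Some (hs, ts) \<Longrightarrow> sorted_wrt (term_gt \<sigma>) ts"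
  shows "invariant F s' \<and>
    (\<forall>hs ts. lb = Some (hs, ts) \<longrightarrow> (\<forall>(g, t)\<in>marked_interreduction hs ts. t = LT \<sigma> g))"
  using step
proof cases
  case (T1_T2 hs E ts U)
  have E: "E = mark ` F" using inv T1_T2 by simp
  have hs: "fst m \<noteq> 0 \<and> snd m = LT \<sigma> (fst m)" if "m \<in> set hs" for m
    using that T1_T2 E F(2) by (auto simp: mark_def)
  obtain H where H: "marked_interreduction hs ts = mark ` H" "reduced H" "K_span H = K_span (fst ` set hs)"
    using marked_interreduction_reduced[OF hs T1_T2(6)] sorted T1_T2(2) by blast
  have span: "K_span H = K_span F" using H(3) T1_T2(4) E by simp
  have U: "U = order_ideal_spanned (supp_set F)" using T1_T2(7) E by simp
  have "sound F U H"
    unfolding sound_def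
  proof (intro conjI)
    have "supp_set H \<subseteq> supp_set F"
      using keys_K_span[of _ F] poly_vs.span_superset[of H] span by (fastforce simp: supp_set_def)
    then show "supp_set H \<subseteq> U" using order_ideal_spanned_superset U by blast
    show "order_ideal U"
      unfolding U using F(1) by (intro order_ideal_order_ideal_spanned) (simp add: supp_set_def)
    have "supp_set F \<noteq> {}" using F(2,3) by (auto simp: supp_set_def)
    then show "U \<noteq> {}" using order_ideal_spanned_superset[of "supp_set F"] U by auto
    show "F \<subseteq> K_span H" unfolding span by (rule poly_vs.span_superset)
    have "K_span F \<subseteq> ideal_generated F" by (rule K_span_subset_ideal[OF ideal.span_superset])
    then show "H \<subseteq> ideal_generated F" using span poly_vs.span_superset[of H] by auto
  qed (rule H(2))
  then show ?thesis using T1_T2 H(1) by (auto simp: mark_def)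
next
  case (T3 xs V ys ts V' W' U)
  obtain G where G: "V = mark ` G" "sound F U G" using inv T3 by auto
  obtain H where H: "marked_interreduction (xs @ ys) ts = mark ` H" "reduced H"
      "K_span H = K_span (polys_plus G)"
    using T3_interreduction[OF G(2), of xs ys ts] T3 G(1) sorted by metis
  have "V' = mark ` {h \<in> H. LT \<sigma> h \<in> LT \<sigma> ` G}" "W' = mark ` {h \<in> H. LT \<sigma> h \<notin> LT \<sigma> ` G}"
    using T3 H(1) G(1) by (auto simp: mark_def image_iff)
  then show ?thesis using G H T3 by (auto simp: mark_def)
next
  case (T4_T5 W W' U V V')
  obtain G H where *: "V = mark ` G" "sound F U G" "reduced H" "K_span H = K_span (polys_plus G)"
      "V' = mark ` {h \<in> H. LT \<sigma> h \<in> LT \<sigma> ` G}" "W' = mark ` {h \<in> H. LT \<sigma> h \<notin> LT \<sigma> ` G}"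
    using inv T4_T5 by auto
  have "fst ` W \<subseteq> H" using *(6) T4_T5 by auto
  then have "finite (fst ` W)" using *(3) finite_subset by (auto simp: reduced_def)
  then have "finite (supp_set (fst ` W))" unfolding supp_set_def by (rule finite_UN_I) simp
  then have "finite (U \<union> supp_set (fst ` W))"
    using *(2) by (simp add: sound_def order_ideal_def)
  then have "sound F (order_ideal_spanned (U \<union> supp_set (fst ` W))) G"
    using *(2) order_ideal_spanned_superset[of "U \<union> supp_set (fst ` W)"]
    by (intro sound_mono[OF *(2)] order_ideal_order_ideal_spanned) auto
  then show ?thesis using * T4_T5 by auto
next
  case (T6_continue W W' U V V')
  obtain G H where *: "V = mark ` G" "sound F U G" "reduced H" "K_span H = K_span (polys_plus G)"
      "V' = mark ` {h \<in> H. LT \<sigma> h \<in> LT \<sigma> ` G}" "W' = mark ` {h \<in> H. LT \<sigma> h \<notin> LT \<sigma> ` G}"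
    using inv T6_continue by auto
  have W: "W = mark ` {h \<in> H. LT \<sigma> h \<notin> LT \<sigma> ` G \<and> LT \<sigma> h \<in> U}" using T6_continue *(6) by auto
  then have "sound F U {h \<in> H. LT \<sigma> h \<in> U}"
    using T6_continue by (intro sound_extension[OF *(2-4)]) simp
  moreover have "V' \<union> W = mark ` {h \<in> H. LT \<sigma> h \<in> U}"
    using W *(5) sound_LT_subset[OF *(2)] by auto
  ultimately show ?thesis using T6_continue by auto
next
  case (T6_exit W' U V V')
  obtain G H where *: "V = mark ` G" "sound F U G" "reduced H" "K_span H = K_span (polys_plus G)"
      "W' = mark ` {h \<in> H. LT \<sigma> h \<notin> LT \<sigma> ` G}"
    using inv T6_exit by auto
  have "stable U G"
  proof (rule stable_if_no_extension[OF *(3,4)], rule ccontr)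
    fix h assume "h \<in> H" "LT \<sigma> h \<in> U" "LT \<sigma> h \<notin> LT \<sigma> ` G"
    then have "mark h \<in> {w \<in> W'. snd w \<in> U}" using *(5) by simp
    then show False using T6_exit by blast
  qed
  then show ?thesis using * T6_exit by auto
next
  case (T7_failure U V)
  obtain G where G: "V = mark ` G" "sound F U G" "stable U G" using inv T7_failure by auto
  have "order_ideal (U - LT \<sigma> ` G)"
    using G by (intro stable_order_ideal) (auto simp: sound_def reduced_def)
  then show ?thesis using T7_failure G(1) by simp
next
  case (T8 S U V)
  obtain G where G: "V = mark ` G" "sound F U G" "stable U G" using inv T8 by auto
  have "sound F (terms_plus U) G"
    using G(2) by (intro sound_mono[OF G(2)] order_ideal_terms_plus) (auto simp: sound_def terms_plus_def)
  then show ?thesis using T8 G(1) by auto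
next
  case (T9 S U V)
  obtain G where G: "V = mark ` G" "sound F U G" "stable U G" using inv T9 by auto
  have S: "S = U - LT \<sigma> ` G" using T9 G(1) by simp
  have "fst ` {g \<in> V. snd g \<in> border S} = {g \<in> G. LT \<sigma> g \<in> border S}"
    using G(1) by force
  then show ?thesis
    using T9 S stable_border_basis[OF sound_stable[OF G(2,3)]] G(2) by (auto simp: sound_def)
qed

lemma ex_mark_list:
  assumes "finite A"
  shows "\<exists>hs. set hs = mark ` A \<and> distinct (map fst hs)"
proof -
  obtain fs where "set fs = A" "distinct fs" using finite_distinct_list[OF assms] by blast
  then show ?thesis by (intro exI[of _ "map mark fs"]) (simp add: comp_def)
qed

text \<open>Apart from the output, only the failure state, which the invariant excludes, has no successor:
  enumerations of terms and of marked polynomials always exist, and the conditions of the other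
  transitions are complementary.\<close>

lemma bba_progress:
  fixes F :: "('x, 'k::field) mpoly set"
  assumes F: "finite F" and inv: "invariant F s" and stuck: "\<nexists>lb s'. bba_step s lb s'"
  shows "\<exists>V S. s = Output V S"
proof (cases s)
  case (Input V)
  then obtain hs where "set hs = V" "distinct (map fst hs)" using ex_mark_list[OF F] inv by auto
  moreover obtain ts where "term_enumeration hs ts" using ex_term_enumeration by blast
  ultimately show ?thesis using T1_T2 stuck Input by blast
next
  case (At_T3 V U)
  then obtain G where G: "V = mark ` G" "sound F U G" using inv by auto
  then have fin: "finite G" and G0: "0 \<notin> G" by (auto simp: sound_def reduced_def)
  obtain xs where xs: "set xs = V" "distinct (map fst xs)" using ex_mark_list[OF fin] G(1) by auto
  obtain ys where ys: "set ys = mark ` (polys_plus G - G)" "distinct (map fst ys)"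
    using ex_mark_list[of "polys_plus G - G"] finite_polys_plus[OF fin] by auto
  have "marked_extension V ys"
    unfolding marked_extension_def
  proof (intro conjI ballI)
    fix m assume "m \<in> set ys"
    then obtain h where h: "m = mark h" "h \<in> polys_plus G - G" using ys(1) by auto
    obtain v i where v: "v \<in> G" "h = var_poly i * v" using h(2) by (auto simp: polys_plus_def)
    have "v \<noteq> 0" using v G0 by auto
    then have "LT \<sigma> h = var_term i + LT \<sigma> v" using v by (simp add: LT_var_times)
    then show "case m of (h, t') \<Rightarrow> \<exists>(v, t)\<in>V. \<exists>i. h = var_poly i * v \<and> t' = var_term i + t"
      using h(1) v G(1) by (fastforce simp: mark_def)
  qed (use ys G(1) in simp_all)
  moreover obtain ts where "term_enumeration (xs @ ys) ts" using ex_term_enumeration by blast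
  ultimately show ?thesis using bba_step.T3[OF xs] stuck At_T3 by blast
next
  case (At_T4 V U V' W')
  have "\<exists>lb s'. bba_step s lb s'"
    unfolding At_T4 using T4_T5[OF refl, of W' U V V'] T6_continue[OF refl, of W' U V V']
      T6_exit[of W' U V V'] by blast
  then show ?thesis using stuck by blast
next
  case (At_T7 V U)
  have "\<exists>lb s'. bba_step s lb s'"
    unfolding At_T7 using T7_failure[of U V] T8[OF refl, where U = U and V = V]
      T9[OF refl, where U = U and V = V] by blast
  then show ?thesis using stuck by blast
qed (use inv in auto)

end

section \<open>Termination\<close>

text \<open>(T8) is executed only as long as \<open>U\<close> does not contain all terms up to the degree \<open>D\<close> of
  \<open>border_bound\<close>, and it makes \<open>U\<close> contain all terms of one more degree.\<close>

definition missing_degrees :: "nat \<Rightarrow> 'x::finite pterm set \<Rightarrow> nat" where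
  "missing_degrees D U = card {d. d \<le> D \<and> \<not> terms_upto d \<subseteq> U}"

definition max_degree :: "'x::finite pterm set \<Rightarrow> nat" where
  "max_degree U = Max (deg_term ` U)"

text \<open>The first component decreases in (T8), the second one in (T6) and the fourth one in (T5); the
  third one counts down the control points on the way to (T7). The second and the fourth component refer to \<open>U\<close> only through its
  maximal degree, or through terms up to this degree, so that an enlargement of \<open>U\<close> in (T5) does not
  increase them. The initial value exceeds \<open>D + 1\<close>, the maximal number of missing degrees.\<close>

primrec progress_measure :: "nat \<Rightarrow> ('x::finite, 'k::field) bba_state \<Rightarrow> nat \<times> nat \<times> nat \<times> nat" where
  "progress_measure D (Input V) = (Suc (Suc D), 0, 0, 0)"
| "progress_measure D (At_T3 V U) =
     (missing_degrees D U, card (terms_upto (max_degree U) - snd ` V), 3, 0)"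
| "progress_measure D (At_T4 V U V' W') =
     (missing_degrees D U, card (terms_upto (max_degree U) - snd ` V), 2, card (terms_upto (max_degree U) - U))"
| "progress_measure D (At_T7 V U) =
     (missing_degrees D U, card (terms_upto (max_degree U) - snd ` V), 1, 0)"
| "progress_measure D Failed = (0, 0, 0, 0)"
| "progress_measure D (Output V S) = (0, 0, 0, 0)"

lemma missing_degrees_mono: "U \<subseteq> U' \<Longrightarrow> missing_degrees D U' \<le> missing_degrees D U"
  unfolding missing_degrees_def by (rule card_mono) auto

lemma missing_degrees_le: "missing_degrees D U \<le> Suc D"
proof -
  have "missing_degrees D U \<le> card {..D}" unfolding missing_degrees_def by (rule card_mono) auto
  then show ?thesis by simp
qed

lemma missing_degrees_terms_plus:
  assumes "0 \<in> U" and "\<not> terms_upto D \<subseteq> U"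
  shows "missing_degrees D (terms_plus U) < missing_degrees D U"
  unfolding missing_degrees_def
proof (rule psubset_card_mono)
  define d where "d = (LEAST d. \<not> terms_upto d \<subseteq> U)"
  have d: "\<not> terms_upto d \<subseteq> U" unfolding d_def by (rule LeastI[of _ D]) (rule assms(2))
  have "d \<le> D" unfolding d_def by (rule Least_le) (rule assms(2))
  have "d \<noteq> 0" using d assms(1) by (auto simp: terms_upto_def)
  then obtain e where e: "d = Suc e" using not0_implies_Suc by blast
  then have "terms_upto e \<subseteq> U" using not_less_Least[of e "\<lambda>d. \<not> terms_upto d \<subseteq> U"] by (simp add: d_def)
  then have "terms_upto d \<subseteq> terms_plus U" unfolding e terms_plus_upto[symmetric] terms_plus_def by blast
  then show "{d. d \<le> D \<and> \<not> terms_upto d \<subseteq> terms_plus U} \<subset> {d. d \<le> D \<and> \<not> terms_upto d \<subseteq> U}"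
    using d \<open>d \<le> D\<close> by (auto simp: terms_plus_def)
qed simp

lemma subset_upto_max_degree: "finite U \<Longrightarrow> U \<subseteq> terms_upto (max_degree U)"
  by (auto simp: terms_upto_def max_degree_def)

lemma max_degree_eqI:
  assumes "finite U'" "U \<noteq> {}" "U \<subseteq> U'" "U' \<subseteq> terms_upto (max_degree U)"
  shows "max_degree U' = max_degree U"
proof (rule antisym)
  show "max_degree U' \<le> max_degree U"
    using assms unfolding max_degree_def[of U'] by (subst Max_le_iff) (auto simp: terms_upto_def)
  show "max_degree U \<le> max_degree U'"
    unfolding max_degree_def using assms by (intro Max_mono) auto
qed

context degree_ordering
begin

lemma bba_step_decreases:
  fixes F :: "('x, 'k::field) mpoly set"
  assumes bound: "\<And>U G. stabilized F U G \<Longrightarrow> terms_upto D \<subseteq> U \<Longrightarrow> border (U - LT \<sigma> ` G) \<subseteq> U"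
    and inv: "invariant F s" and step: "bba_step s lb s'"
  shows "(progress_measure D s', progress_measure D s) \<in>
    less_than <*lex*> less_than <*lex*> less_than <*lex*> less_than"
  using step
proof cases
  case (T1_T2 hs E ts U)
  then show ?thesis using missing_degrees_le[of D U] by simp
next
  case (T4_T5 W W' U V V')
  obtain G H where *: "V = mark ` G" "sound F U G" "reduced H"
      "W' = mark ` {h \<in> H. LT \<sigma> h \<notin> LT \<sigma> ` G}"
    using inv T4_T5 by auto
  let ?X = "U \<union> supp_set (fst ` W)" and ?d = "max_degree U"
  have U: "finite U" "U \<noteq> {}" using *(2) by (auto simp: sound_def order_ideal_def)
  have "Poly_Mapping.keys w \<subseteq> terms_upto ?d" if "w \<in> fst ` W" for w
  proof -
    have "LT \<sigma> w \<in> U" using that *(4) T4_T5 by auto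
    then have "deg_term (LT \<sigma> w) \<le> ?d" using subset_upto_max_degree[OF U(1)] by (auto simp: terms_upto_def)
    then show ?thesis using keys_subset_upto_LT terms_upto_mono by blast
  qed
  then have "?X \<subseteq> terms_upto ?d" using subset_upto_max_degree[OF U(1)] by (auto simp: supp_set_def)
  then have X: "order_ideal_spanned ?X \<subseteq> terms_upto ?d" by (rule order_ideal_spanned_subset_upto)
  have sup: "?X \<subseteq> order_ideal_spanned ?X" by (rule order_ideal_spanned_superset)
  have eq: "max_degree (order_ideal_spanned ?X) = ?d"
    using U(2) sup by (intro max_degree_eqI finite_subset[OF X] X) auto
  have "card (terms_upto ?d - order_ideal_spanned ?X) < card (terms_upto ?d - U)"
    using T4_T5 sup X by (intro psubset_card_mono) auto
  moreover have "missing_degrees D (order_ideal_spanned ?X) \<le> missing_degrees D U"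
    using sup by (intro missing_degrees_mono) auto
  ultimately show ?thesis using T4_T5 eq by auto
next
  case (T6_continue W W' U V V')
  obtain G H where *: "V = mark ` G" "sound F U G" "reduced H" "K_span H = K_span (polys_plus G)"
      "V' = mark ` {h \<in> H. LT \<sigma> h \<in> LT \<sigma> ` G}" "W' = mark ` {h \<in> H. LT \<sigma> h \<notin> LT \<sigma> ` G}"
    using inv T6_continue by auto
  have U: "finite U" using *(2) by (auto simp: sound_def order_ideal_def)
  have "LT \<sigma> ` G \<subseteq> LT \<sigma> ` {h \<in> H. LT \<sigma> h \<in> LT \<sigma> ` G}"
  proof
    fix t assume t: "t \<in> LT \<sigma> ` G"
    then obtain g where g: "g \<in> G" "t = LT \<sigma> g" by auto
    have "g \<in> K_span H" using g(1) *(4) polys_plus_superset poly_vs.span_base by blast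
    moreover have "g \<noteq> 0" using g(1) *(2) by (auto simp: sound_def reduced_def)
    ultimately obtain h where "h \<in> H" "LT \<sigma> g = LT \<sigma> h" using reduced_LT_span[OF *(3)] by blast
    then show "t \<in> LT \<sigma> ` {h \<in> H. LT \<sigma> h \<in> LT \<sigma> ` G}" using g(2) t by auto
  qed
  then have "snd ` V \<subseteq> snd ` V'" using *(1,5) by simp
  moreover obtain w where w: "w \<in> W" using T6_continue by blast
  moreover have "snd w \<in> U" "w \<in> W'" using w T6_continue by auto
  moreover from this(2) have "snd w \<notin> snd ` V" unfolding *(1,6) by auto
  moreover have "snd w \<in> terms_upto (max_degree U)" using \<open>snd w \<in> U\<close> subset_upto_max_degree[OF U] by auto
  ultimately have "card (terms_upto (max_degree U) - snd ` (V' \<union> W)) < card (terms_upto (max_degree U) - snd ` V)"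
    by (intro psubset_card_mono) auto
  then show ?thesis using T6_continue by simp
next
  case (T8 S U V)
  obtain G where G: "V = mark ` G" "sound F U G" "stable U G" using inv T8 by auto
  have "0 \<in> U" using G(2) unfolding sound_def order_ideal_def by (metis ex_in_conv term_dvd_zero)
  moreover have "\<not> terms_upto D \<subseteq> U"
    using bound[OF sound_stable[OF G(2,3)]] T8 G(1) by auto
  ultimately show ?thesis using missing_degrees_terms_plus[of U D] T8 by simp
qed auto

end

theorem mainTheorem3:
  fixes \<sigma> :: "'x::finite pterm rel"
    and F :: "('x, 'k::field) mpoly set"
    and I :: "('x, 'k) mpoly set"
    and N :: enat
    and St :: "nat \<Rightarrow> ('x, 'k) bba_state"
    and Lb :: "nat \<Rightarrow> ('x, 'k) bba_label"
  assumes "term_ordering \<sigma>" and "degree_compatible \<sigma>"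
    and "finite F" and "0 \<notin> F"
    and "\<And>f g. f \<in> F \<Longrightarrow> g \<in> F \<Longrightarrow> f \<noteq> g \<Longrightarrow> LT \<sigma> f \<notin> Poly_Mapping.keys g"
    and "I = ideal_generated F" and "zero_dimensional I"
    and execution: "bba_execution ((\<lambda>f. (f, LT \<sigma> f)) ` F) N St Lb"
    and enumerations: "\<And>k hs ts. enat k < N \<Longrightarrow> Lb k = Some (hs, ts) \<Longrightarrow> sorted_wrt (term_gt \<sigma>) ts"
  shows "(\<forall>k hs ts. enat k < N \<longrightarrow> Lb k = Some (hs, ts) \<longrightarrow>
            (\<forall>(g, t)\<in>marked_interreduction hs ts. t = LT \<sigma> g)) \<and>
         (\<exists>G. bba_output N St G (LT_complement \<sigma> I) \<and>
              is_border_basis (LT_complement \<sigma> I) (fst ` G) I)"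
proof -
  interpret degree_ordering \<sigma> using assms(1,2) by unfold_locales
  have zero_dim: "zero_dimensional (ideal_generated F)" using assms(6,7) by simp
  note F = \<open>finite F\<close> \<open>0 \<notin> F\<close> zero_dimensional_nonempty[OF zero_dim]
  have start: "St 0 = Input (mark ` F)" and steps: "\<And>k. enat k < N \<Longrightarrow> bba_step (St k) (Lb k) (St (Suc k))"
    and stop: "\<And>k. N = enat k \<Longrightarrow> \<nexists>lb s. bba_step (St k) lb s"
    using execution by (auto simp: bba_execution_def mark_def)
  have inv: "enat k \<le> N \<Longrightarrow> invariant F (St k)" for k
  proof (induction k)
    case (Suc k)
    then have "enat k < N" by (simp add: Suc_ile_eq)
    then show ?case using Suc.IH bba_step_invariant[OF F _ steps] enumerations by simp
  qed (simp add: start)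
  have marked: "\<forall>(g, t)\<in>marked_interreduction hs ts. t = LT \<sigma> g"
    if "enat k < N" "Lb k = Some (hs, ts)" for k hs ts
  proof -
    have "enat k \<le> N" using that(1) by simp
    from bba_step_invariant[OF F inv[OF this] steps[OF that(1)]] enumerations[OF that(1)] that(2)
    show ?thesis by blast
  qed
  obtain D where D: "\<And>U G. stabilized F U G \<Longrightarrow> terms_upto D \<subseteq> U \<Longrightarrow> border (U - LT \<sigma> ` G) \<subseteq> U"
    using border_bound[OF zero_dim] by blast
  have "N \<noteq> \<infinity>"
  proof
    assume "N = \<infinity>"
    then have "\<forall>k. (progress_measure D (St (Suc k)), progress_measure D (St k)) \<in>
        less_than <*lex*> less_than <*lex*> less_than <*lex*> less_than"
      using bba_step_decreases[OF D inv steps] by simp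
    then have "\<exists>f. \<forall>k. (f (Suc k), f k) \<in> less_than <*lex*> less_than <*lex*> less_than <*lex*> less_than"
      by (rule exI[of _ "\<lambda>k. progress_measure D (St k)"])
    moreover have "wf (less_than <*lex*> less_than <*lex*> less_than <*lex*> less_than)"
      by (intro wf_lex_prod wf_less_than)
    ultimately show False unfolding wf_iff_no_infinite_down_chain by blast
  qed
  then obtain m where m: "N = enat m" by auto
  then obtain V S where VS: "St m = Output V S"
    using bba_progress[OF F(1) inv stop] by blast
  have S: "S = LT_complement \<sigma> I" and basis: "is_border_basis S (fst ` V) I"
    using inv[of m] unfolding m VS \<open>I = ideal_generated F\<close> by auto
  have "bba_output N St V (LT_complement \<sigma> I)" using m VS S by (simp add: bba_output_def)
  moreover have "is_border_basis (LT_complement \<sigma> I) (fst ` V) I" using basis S by simp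
  ultimately show ?thesis using marked by blast
qed

end
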